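(* Let $I$ be a nonempty finite set and let $f\in \mathsf{L}^{\vee *}[I]$ be a functional on adjoint chambers. Then $f$ is semisimply differentiable if and only if the first derivatives of $f$ are semisimple, i.e. if and only if $\boldsymbol{\partial}_{\mathcal V}f\in \mathsf{L}^{\vee *}[(S|T)]$ is a semisimple functional for every cut $\mathcal V=[S,T]:(I)\leftarrow (S|T)$. Thus $$\boldsymbol{\Gamma}[I]=\mathsf{L}^\vee[I]\,/\,\mathbf{Stein}[I].$$
   Context: **Arrangement and faces.** $\Bbbk$ is a field of characteristic zero. A partition $P=(S_1|\dots|S_k)$ of $I$ is an unordered set of disjoint nonempty blocks with union $I$; $Q$ is finer than $P$ if every block of $Q$ is contained in a block of $P$ ($Q=P$ allowed). $(I)$ is the one-block partition. Put $T^\vee[P]=\{h\in\mathbb R I:\sum_{i\in S_j}h_i=0 \text{ for all } j\}$ and $T^\vee[I]=T^\vee[(I)]$. The adjoint braid arrangement consists of the hyperplanes $\{\sum_{i\in S}h_i=0\}$ of $T^\vee[I]$, for $\emptyset\ne S\subsetneq I$. An adjoint face $X$ is (the characteristic function of) a relatively open face of this arrangement; it is determined by its sign function $s_X$, where $s_X(S)\in\{+,-,0\}$ is the sign of $\sum_{i\in S}h_i$ for $h$ in the face, $\emptyset\neq S\subsetneq I$. Its support is the linear span of the face. $\mathsf L^\vee[P]$ is the $\Bbbk$-vector space with basis the adjoint faces with support $T^\vee[P]$; $\mathsf L^{\vee *}[P]$ is its dual, whose elements are called functionals; $\mathsf L^\vee[I]:=\mathsf L^\vee[(I)]$ has basis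 the adjoint chambers. **Semisimple functionals.** For $S\subseteq I$, ${}^I S$ is the partition of $I$ with block $S$ and all other blocks singletons. Let $P=(S_1|\dots|S_k)$. For an adjoint face $X\in\mathsf L^\vee[P]$, $X|_{S_j}\in\mathsf L^\vee[{}^IS_j]$ is the adjoint face with sign $S\mapsto s_X(S\cap S_j)$ if $S\cap S_j\ne\emptyset$, and $0$ if $S\cap S_j=\emptyset$. Define $\mathbf{prod}_P:\bigotimes_j\mathsf L^{\vee*}[{}^IS_j]\to\mathsf L^{\vee*}[P]$ by $\mathbf{prod}_P(f_1\otimes\dots\otimes f_k)(X)=\prod_j f_j(X|_{S_j})$. A functional in $\mathsf L^{\vee *}[P]$ is semisimple if it lies in the image of $\mathbf{prod}_P$. **Forest derivative.** For $E\subseteq I$, $\mathrm{Redn}_P(E)$ is $E$ with all blocks of $P$ contained in $E$ removed; write $E=S \bmod P$ if $\mathrm{Redn}_P(E)=\mathrm{Redn}_P(S)$. A cut $\mathcal V=[C,D]:P\leftarrow Q$ is an ordered splitting of one block $S_m=C\sqcup D$ of $P$ ($C,D\neq\emptyset$), where $Q$ is $P$ with $S_m$ replaced by $C$ and $D$; $\overline{\mathcal V}=[D,C]$. For an adjoint face $X\in\mathsf L^\vee[Q]$, $X^{\mathcal V}\in\mathsf L^\vee[P]$ is the adjoint face with sign at $S$ equal to $+$ if $S=C\bmod P$, $-$ if $S=D\bmod P$, $s_X(S)$ if $S\ne\emptyset\bmod Q$, and $0$ if $S=\emptyset\bmod P$. For $f\in\mathsf L^{\vee*}[P]$ set $\boldsymbol\partial_{\mathcal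 V}f(X)=f(X^{\mathcal V})-f(X^{\overline{\mathcal V}})$, a functional in $\mathsf L^{\vee *}[Q]$. A layered forest $\mathcal F:P\leftarrow Q$ over $P$ is a family of planar full binary trees, one over each block $S_j$ of $P$ with leaves labelled bijectively by the blocks of $Q$ contained in $S_j$, together with a linear order on all the (internal) nodes in which each node precedes its descendants. Equivalently it is a sequence of successive cuts, $\mathcal F=\mathcal V_1\circ\dots\circ\mathcal V_l$, performed in the order of the nodes (starting from $P$ and ending at $Q$; at each node the left child gives $C$ and the right child $D$). Set $\boldsymbol\partial_{\mathcal F}f=\boldsymbol\partial_{\mathcal V_l}(\cdots(\boldsymbol\partial_{\mathcal V_1}f)\cdots)$; if $l=0$ (a forest of sticks) this is the identity. **Semisimple differentiability.** $f\in\mathsf L^{\vee*}[P]$ is semisimply differentiable if $\boldsymbol\partial_{\mathcal F}f$ is semisimple for all layered forests $\mathcal F$ over $P$. $\boldsymbol\Gamma^*[P]\subseteq\mathsf L^{\vee *}[P]$ is the subspace of such functionals, and $\boldsymbol\Gamma[P]$ is the quotient of $\mathsf L^\vee[P]$ dual to it, i.e. the quotient by the common kernel of all $f\in\boldsymbol\Gamma^*[P]$. $\boldsymbol\Gamma[I]:=\boldsymbol\Gamma[(I)]$. **Steinmann relations.** Let $P$ be a partition. A subset $E$ with $E\ne\emptyset\bmod P$ is $P$-semisimple if $\mathrm{Redn}_P(E)$ is contained in a single block of $P$. Distinct adjoint faces $X_1,X_2\in\mathsf L^\vee[P]$ are Steinmann adjacent if there is $E\subset I$ with $E\ne\emptyset\bmod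 P$, $E$ not $P$-semisimple, such that $s_{X_1}$ and $s_{X_2}$ differ only on subsets equal to $E\bmod P$ or $I-E\bmod P$. $\mathbf{Stein}[I]\subset\mathsf L^\vee[I]$ is the span of all elements $X_1^{\mathcal V}-X_1^{\overline{\mathcal V}}+X_2^{\overline{\mathcal V}}-X_2^{\mathcal V}$, where $\mathcal V:(I)\leftarrow(S|T)$ ranges over cuts of $I$ into two blocks, and $X_1,X_2\in\mathsf L^\vee[(S|T)]$ range over Steinmann adjacent adjoint faces. *)

theory Defs
  imports Complex_Main "HOL-Library.Function_Algebras" "HOL-Library.Poly_Mapping"
begin

text \<open>Throughout, \<open>I\<close> is a finite nonempty set and \<open>P\<close>, \<open>Q\<close> are partitions of \<open>I\<close> (as sets of
  blocks); no definition below is meant to be used otherwise.\<close>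

subsection \<open>Function spaces and free vector spaces\<close>

definition fun_scale :: "'k::field \<Rightarrow> ('x \<Rightarrow> 'k) \<Rightarrow> 'x \<Rightarrow> 'k" where
  "fun_scale c f = (\<lambda>x. c * f x)"

interpretation fun_space: vector_space "fun_scale :: 'k::field \<Rightarrow> ('x \<Rightarrow> 'k) \<Rightarrow> 'x \<Rightarrow> 'k"
  by unfold_locales (auto simp: fun_scale_def algebra_simps)

definition free_scale :: "'k::field \<Rightarrow> ('x \<Rightarrow>\<^sub>0 'k) \<Rightarrow> 'x \<Rightarrow>\<^sub>0 'k" where
  "free_scale c v = Poly_Mapping.map ((*) c) v"

lemma lookup_free_scale [simp]: "Poly_Mapping.lookup (free_scale c v) x = c * Poly_Mapping.lookup v x"
  by (simp add: free_scale_def Poly_Mapping.map.rep_eq Poly_Mapping.when_def)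

interpretation free_space: vector_space "free_scale :: 'k::field \<Rightarrow> ('x \<Rightarrow>\<^sub>0 'k) \<Rightarrow> 'x \<Rightarrow>\<^sub>0 'k"
  by unfold_locales (auto intro!: poly_mapping_eqI simp: Poly_Mapping.lookup_add algebra_simps)

definition quotient_space :: "'v::ab_group_add set \<Rightarrow> 'v set \<Rightarrow> 'v set set" where
  "quotient_space V W = V // {(x, y). x \<in> V \<and> y \<in> V \<and> x - y \<in> W}"

subsection \<open>The adjoint braid arrangement\<close>

text \<open>Elements of \<open>\<real>I\<close> are the functions \<^typ>\<open>'a \<Rightarrow> real\<close> vanishing outside \<open>I\<close>;
  \<open>Tvee I {I}\<close> is the ambient space of the arrangement.\<close>

definition Tvee :: "'a set \<Rightarrow> 'a set set \<Rightarrow> ('a \<Rightarrow> real) set" where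
  "Tvee I P = {h. (\<forall>i. i \<notin> I \<longrightarrow> h i = 0) \<and> (\<forall>S\<in>P. (\<Sum>i\<in>S. h i) = 0)}"

definition open_face_through :: "'a set \<Rightarrow> ('a \<Rightarrow> real) \<Rightarrow> ('a \<Rightarrow> real) set" where
  "open_face_through I h = {h' \<in> Tvee I {I}.
     \<forall>S. S \<noteq> {} \<and> S \<subset> I \<longrightarrow> sgn (\<Sum>i\<in>S. h' i) = sgn (\<Sum>i\<in>S. h i)}"

definition adjoint_faces :: "'a set \<Rightarrow> 'a set set \<Rightarrow> ('a \<Rightarrow> real) set set" where
  "adjoint_faces I P = {X. (\<exists>h \<in> Tvee I {I}. X = open_face_through I h) \<and> fun_space.span X = Tvee I P}"

definition face_sign :: "('a \<Rightarrow> real) set \<Rightarrow> 'a set \<Rightarrow> real" where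
  "face_sign X S = (THE \<sigma>. \<forall>h\<in>X. sgn (\<Sum>i\<in>S. h i) = \<sigma>)"

definition face_with_sign :: "'a set \<Rightarrow> 'a set set \<Rightarrow> ('a set \<Rightarrow> real) \<Rightarrow> ('a \<Rightarrow> real) set" where
  "face_with_sign I P s =
     (THE X. X \<in> adjoint_faces I P \<and> (\<forall>S. S \<noteq> {} \<and> S \<subset> I \<longrightarrow> face_sign X S = s S))"

text \<open>\<open>Lvee I P\<close> is the free vector space on \<^term>\<open>adjoint_faces I P\<close>. An element of its dual is
  represented by its values on the basis of adjoint faces, set to \<open>0\<close> off the basis so that the
  representation is unique; \<open>pairing\<close> is the evaluation obtained by linear extension.\<close>

definition Lvee :: "'a set \<Rightarrow> 'a set set \<Rightarrow> (('a \<Rightarrow> real) set \<Rightarrow>\<^sub>0 'k::field) set" where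
  "Lvee I P = {v. Poly_Mapping.keys v \<subseteq> adjoint_faces I P}"

definition functionals :: "'a set \<Rightarrow> 'a set set \<Rightarrow> (('a \<Rightarrow> real) set \<Rightarrow> 'k::field) set" where
  "functionals I P = {f. \<forall>X. X \<notin> adjoint_faces I P \<longrightarrow> f X = 0}"

definition pairing :: "(('a \<Rightarrow> real) set \<Rightarrow> 'k::field) \<Rightarrow> (('a \<Rightarrow> real) set \<Rightarrow>\<^sub>0 'k) \<Rightarrow> 'k" where
  "pairing f v = (\<Sum>X\<in>Poly_Mapping.keys v. Poly_Mapping.lookup v X * f X)"

subsection \<open>Semisimple functionals\<close>

definition block_partition :: "'a set \<Rightarrow> 'a set \<Rightarrow> 'a set set" where
  "block_partition I S = insert S ((\<lambda>i. {i}) ` (I - S))"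

definition restrict_face :: "'a set \<Rightarrow> 'a set \<Rightarrow> ('a \<Rightarrow> real) set \<Rightarrow> ('a \<Rightarrow> real) set" where
  "restrict_face I S X = face_with_sign I (block_partition I S)
     (\<lambda>E. if E \<inter> S \<noteq> {} then face_sign X (E \<inter> S) else 0)"

definition prod_functional ::
    "'a set \<Rightarrow> 'a set set \<Rightarrow> ('a set \<Rightarrow> ('a \<Rightarrow> real) set \<Rightarrow> 'k::field) \<Rightarrow> ('a \<Rightarrow> real) set \<Rightarrow> 'k" where
  "prod_functional I P g =
     (\<lambda>X. if X \<in> adjoint_faces I P then \<Prod>S\<in>P. g S (restrict_face I S X) else 0)"

text \<open>The map from the tensor product over the blocks is linear and determined by
  \<^const>\<open>prod_functional\<close> on pure tensors, so its image is the span of the values on pure tensors.\<close>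

definition semisimple :: "'a set \<Rightarrow> 'a set set \<Rightarrow> (('a \<Rightarrow> real) set \<Rightarrow> 'k::field) \<Rightarrow> bool" where
  "semisimple I P f \<longleftrightarrow> f \<in> fun_space.span
     {prod_functional I P g | g. \<forall>S\<in>P. g S \<in> functionals I (block_partition I S)}"

subsection \<open>Forest derivatives\<close>

definition Redn :: "'a set set \<Rightarrow> 'a set \<Rightarrow> 'a set" where
  "Redn P E = E - \<Union>{B \<in> P. B \<subseteq> E}"

definition eq_mod :: "'a set set \<Rightarrow> 'a set \<Rightarrow> 'a set \<Rightarrow> bool" where
  "eq_mod P E S \<longleftrightarrow> Redn P E = Redn P S"

text \<open>A cut \<open>[C, D]\<close> of \<open>P\<close> is the pair \<open>(C, D)\<close>.\<close>

fun is_cut :: "'a set set \<Rightarrow> 'a set \<times> 'a set \<Rightarrow> bool" where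
  "is_cut P (C, D) \<longleftrightarrow> C \<noteq> {} \<and> D \<noteq> {} \<and> C \<inter> D = {} \<and> C \<union> D \<in> P"

fun cut_partition :: "'a set set \<Rightarrow> 'a set \<times> 'a set \<Rightarrow> 'a set set" where
  "cut_partition P (C, D) = (P - {C \<union> D}) \<union> {C, D}"

fun cut_face :: "'a set \<Rightarrow> 'a set set \<Rightarrow> 'a set \<times> 'a set \<Rightarrow> ('a \<Rightarrow> real) set \<Rightarrow> ('a \<Rightarrow> real) set" where
  "cut_face I P (C, D) X = face_with_sign I P
     (\<lambda>S. if eq_mod P S C then 1
          else if eq_mod P S D then - 1
          else if \<not> eq_mod (cut_partition P (C, D)) S {} then face_sign X S
          else 0)"

definition cut_deriv :: "'a set \<Rightarrow> 'a set set \<Rightarrow> 'a set \<times> 'a set \<Rightarrow>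
    (('a \<Rightarrow> real) set \<Rightarrow> 'k::field) \<Rightarrow> ('a \<Rightarrow> real) set \<Rightarrow> 'k" where
  "cut_deriv I P V f = (\<lambda>X. if X \<in> adjoint_faces I (cut_partition P V)
     then f (cut_face I P V X) - f (cut_face I P (prod.swap V) X) else 0)"

text \<open>A layered forest over \<open>P\<close> is given as the sequence of successive cuts at its nodes.\<close>

fun layered_forest :: "'a set set \<Rightarrow> ('a set \<times> 'a set) list \<Rightarrow> bool" where
  "layered_forest P [] \<longleftrightarrow> True"
| "layered_forest P (V # F) \<longleftrightarrow> is_cut P V \<and> layered_forest (cut_partition P V) F"

fun forest_partition :: "'a set set \<Rightarrow> ('a set \<times> 'a set) list \<Rightarrow> 'a set set" where
  "forest_partition P [] = P"
| "forest_partition P (V # F) = forest_partition (cut_partition P V) F"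

fun forest_deriv :: "'a set \<Rightarrow> 'a set set \<Rightarrow> ('a set \<times> 'a set) list \<Rightarrow>
    (('a \<Rightarrow> real) set \<Rightarrow> 'k::field) \<Rightarrow> ('a \<Rightarrow> real) set \<Rightarrow> 'k" where
  "forest_deriv I P [] f = f"
| "forest_deriv I P (V # F) f = forest_deriv I (cut_partition P V) F (cut_deriv I P V f)"

definition semisimply_differentiable ::
    "'a set \<Rightarrow> 'a set set \<Rightarrow> (('a \<Rightarrow> real) set \<Rightarrow> 'k::field) \<Rightarrow> bool" where
  "semisimply_differentiable I P f \<longleftrightarrow>
     (\<forall>F. layered_forest P F \<longrightarrow> semisimple I (forest_partition P F) (forest_deriv I P F f))"

definition Gamma_star :: "'a set \<Rightarrow> 'a set set \<Rightarrow> (('a \<Rightarrow> real) set \<Rightarrow> 'k::field) set" where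
  "Gamma_star I P = {f \<in> functionals I P. semisimply_differentiable I P f}"

definition Gamma :: "'a set \<Rightarrow> 'a set set \<Rightarrow> (('a \<Rightarrow> real) set \<Rightarrow>\<^sub>0 'k::field) set set" where
  "Gamma I P = quotient_space (Lvee I P) {v \<in> Lvee I P. \<forall>f \<in> Gamma_star I P. pairing f v = 0}"

subsection \<open>Steinmann relations\<close>

definition semisimple_subset :: "'a set set \<Rightarrow> 'a set \<Rightarrow> bool" where
  "semisimple_subset P E \<longleftrightarrow> \<not> eq_mod P E {} \<and> (\<exists>B\<in>P. Redn P E \<subseteq> B)"

definition steinmann_adjacent ::
    "'a set \<Rightarrow> 'a set set \<Rightarrow> ('a \<Rightarrow> real) set \<Rightarrow> ('a \<Rightarrow> real) set \<Rightarrow> bool" where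
  "steinmann_adjacent I P X1 X2 \<longleftrightarrow>
     X1 \<in> adjoint_faces I P \<and> X2 \<in> adjoint_faces I P \<and> X1 \<noteq> X2 \<and>
     (\<exists>E. E \<subset> I \<and> \<not> eq_mod P E {} \<and> \<not> semisimple_subset P E \<and>
        (\<forall>S. S \<noteq> {} \<and> S \<subset> I \<and> face_sign X1 S \<noteq> face_sign X2 S \<longrightarrow>
             eq_mod P S E \<or> eq_mod P S (I - E)))"

definition Stein :: "'a set \<Rightarrow> (('a \<Rightarrow> real) set \<Rightarrow>\<^sub>0 'k::field) set" where
  "Stein I = free_space.span
     {Poly_Mapping.single (cut_face I {I} (S, T) X1) 1 - Poly_Mapping.single (cut_face I {I} (T, S) X1) 1
        + Poly_Mapping.single (cut_face I {I} (T, S) X2) 1 - Poly_Mapping.single (cut_face I {I} (S, T) X2) 1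
      | S T X1 X2. is_cut {I} (S, T) \<and> steinmann_adjacent I {S, T} X1 X2}"

end

(* Work with sign functions: a face with support T[P] is the sign function s of a vector that is
   generic in T[P], and cutting along V = [C, D] only breaks the ties of s, in favour of C.

   A functional is semisimple iff its value depends only on the signs of subsets of single blocks.
   If two faces agree on these, a generic segment between the corresponding vectors crosses the
   hyperplanes one at a time, and each crossing is a Steinmann adjacency; so semisimplicity means
   invariance under Steinmann adjacency.

   It remains to see that semisimplicity of f and of its first derivatives passes to the second
   derivative of f along V and then W. Let two faces differ only on sets splitting two blocks B1, B2.
   If B1, B2 lie in different blocks after V, semisimplicity of the V-derivative suffices. Otherwise
   W = [B1, B2] up to order. If W cuts a block that V leaves alone, the two derivatives commute,
   because f is semisimple. If W cuts a part of V, a Jacobi identity for the three parts A, B, C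
   expresses the derivative along [A, B] inside [AB, C] by those along [B, C] inside [BC, A] and
   [C, A] inside [CA, B], whose first cuts separate A from B.

   The second claim is the double annihilator of the span of the Steinmann relations. *)

theory Submission
  imports Defs "HOL-Library.Disjoint_Sets"
begin

section \<open>Sign functions, saturated sets and generic vectors\<close>

text \<open>Intersecting with \<open>I\<close> makes a sign function determined by its values on
  subsets of \<open>I\<close>, so that equality of faces can become equality of functions.\<close>

definition sign_of :: "'a set \<Rightarrow> ('a \<Rightarrow> real) \<Rightarrow> 'a set \<Rightarrow> real" where
  "sign_of I h = (\<lambda>S. sgn (\<Sum>i\<in>S \<inter> I. h i))"

definition face_of :: "'a set \<Rightarrow> ('a set \<Rightarrow> real) \<Rightarrow> ('a \<Rightarrow> real) set" where
  "face_of I s = {h \<in> Tvee I {I}. sign_of I h = s}"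

text \<open>Inside \<open>I\<close> these are the unions of blocks, that is the sets equal to the
  empty set mod \<open>P\<close> (\<open>eq_mod_empty_iff\<close>). They index the hyperplanes that
  contain all of \<open>Tvee I P\<close>.\<close>

definition saturated :: "'a set set \<Rightarrow> 'a set \<Rightarrow> bool" where
  "saturated P S \<longleftrightarrow> (\<forall>B\<in>P. B \<subseteq> S \<or> B \<inter> S = {})"

text \<open>The point avoids every hyperplane that does not contain all of \<open>Tvee I P\<close>;
  such points are exactly those whose face spans \<open>Tvee I P\<close>.\<close>

definition generic :: "'a set \<Rightarrow> 'a set set \<Rightarrow> ('a \<Rightarrow> real) \<Rightarrow> bool" where
  "generic I P h \<longleftrightarrow> h \<in> Tvee I P \<and> (\<forall>S\<subseteq>I. sum h S = 0 \<longrightarrow> saturated P S)"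

text \<open>These functions stand for the faces with support \<open>Tvee I P\<close>; the
  correspondence is \<open>adjoint_faces_eq\<close> together with
  \<open>face_of_inject\<close>.\<close>

definition signs :: "'a set \<Rightarrow> 'a set set \<Rightarrow> ('a set \<Rightarrow> real) set" where
  "signs I P = sign_of I ` {h. generic I P h}"

lemma sign_of_subset: "S \<subseteq> I \<Longrightarrow> sign_of I h S = sgn (sum h S)"
  by (simp add: sign_of_def Int_absorb2)

lemma sign_of_eq_iff:
  "sign_of I h = sign_of I h' \<longleftrightarrow> (\<forall>S\<subseteq>I. sgn (sum h S) = sgn (sum h' S))"
  unfolding sign_of_def by (metis (no_types, lifting) Int_absorb2 inf_le2)

lemma Redn_subset: "Redn P S \<subseteq> S"
  by (auto simp: Redn_def)

context
  fixes I :: "'a set" and P :: "'a set set"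
  assumes part: "partition_on I P"
begin

lemma same_block: "B \<in> P \<Longrightarrow> B' \<in> P \<Longrightarrow> x \<in> B \<Longrightarrow> x \<in> B' \<Longrightarrow> B = B'"
  using part by (auto simp: partition_on_def disjoint_def)

lemma block_subset: "B \<in> P \<Longrightarrow> B \<subseteq> I"
  using part by (auto simp: partition_on_def)

lemma in_some_block: "x \<in> I \<Longrightarrow> \<exists>B\<in>P. x \<in> B"
  using part by (auto simp: partition_on_def)

lemma Redn_iff: "S \<subseteq> I \<Longrightarrow> x \<in> Redn P S \<longleftrightarrow> x \<in> S \<and> (\<exists>B\<in>P. x \<in> B \<and> \<not> B \<subseteq> S)"
  unfolding Redn_def using in_some_block[of x] same_block[where x = x] by blast

lemma Redn_empty_iff: "S \<subseteq> I \<Longrightarrow> Redn P S = {} \<longleftrightarrow> saturated P S"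
  using Redn_iff[of S] unfolding saturated_def by blast

lemma eq_mod_empty_iff: "S \<subseteq> I \<Longrightarrow> eq_mod P S {} \<longleftrightarrow> saturated P S"
  using Redn_empty_iff[of S] Redn_subset[of P "{}"] by (auto simp: eq_mod_def)

context
  assumes fin: "finite I"
begin

text \<open>A saturated set is the disjoint union of the blocks that it contains, and
  \<open>h\<close> sums to 0 on each of them.\<close>

lemma Tvee_sum_saturated:
  assumes h: "h \<in> Tvee I P" and S: "S \<subseteq> I" "saturated P S"
  shows "sum h S = 0"
proof -
  have eq: "S = \<Union>{B\<in>P. B \<subseteq> S}"
  proof
    show "S \<subseteq> \<Union>{B\<in>P. B \<subseteq> S}"
    proof
      fix x assume x: "x \<in> S"
      then obtain B where "B \<in> P" "x \<in> B" using in_some_block S by blast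
      with x S show "x \<in> \<Union>{B\<in>P. B \<subseteq> S}" unfolding saturated_def by blast
    qed
  qed auto
  have fb: "\<And>B. B \<in> P \<Longrightarrow> finite B" using block_subset fin finite_subset by blast
  have "sum h (\<Union>{B\<in>P. B \<subseteq> S}) = (\<Sum>B\<in>{B\<in>P. B \<subseteq> S}. sum h B)"
  proof (rule sum.Union_disjoint[unfolded comp_def])
    show "\<forall>A\<in>{B \<in> P. B \<subseteq> S}. \<forall>B\<in>{B \<in> P. B \<subseteq> S}. A \<noteq> B \<longrightarrow> A \<inter> B = {}"
      using same_block by blast
  qed (use fb in auto)
  also have "\<dots> = 0" using h by (intro sum.neutral) (auto simp: Tvee_def)
  finally show ?thesis using eq by simp
qed

lemma Tvee_whole: "h \<in> Tvee I P \<Longrightarrow> h \<in> Tvee I {I}"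
  using Tvee_sum_saturated[of h I] block_subset by (auto simp: Tvee_def saturated_def)

lemma sum_Redn:
  assumes h: "h \<in> Tvee I P" and S: "S \<subseteq> I"
  shows "sum h (Redn P S) = sum h S"
proof -
  have sub: "\<Union>{B\<in>P. B \<subseteq> S} \<subseteq> S" by auto
  have "saturated P (\<Union>{B\<in>P. B \<subseteq> S})"
    using same_block unfolding saturated_def by blast
  then have "sum h (\<Union>{B\<in>P. B \<subseteq> S}) = 0"
    using Tvee_sum_saturated[OF h] sub S by blast
  then show ?thesis
    unfolding Redn_def using sum_diff[OF finite_subset[OF S fin] sub, of h] by simp
qed

lemma generic_zero_iff: "generic I P h \<Longrightarrow> S \<subseteq> I \<Longrightarrow> sum h S = 0 \<longleftrightarrow> saturated P S"
  using Tvee_sum_saturated by (auto simp: generic_def)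

lemma signs_zero_iff: "s \<in> signs I P \<Longrightarrow> S \<subseteq> I \<Longrightarrow> s S = 0 \<longleftrightarrow> saturated P S"
  by (auto simp: signs_def sign_of_subset sgn_0_0 generic_zero_iff)

lemma signs_Redn: "s \<in> signs I P \<Longrightarrow> S \<subseteq> I \<Longrightarrow> s (Redn P S) = s S"
  using Redn_subset[of P S] by (auto simp: signs_def sign_of_subset sum_Redn generic_def)

lemma signs_Int: "s \<in> signs I P \<Longrightarrow> s (S \<inter> I) = s S"
  by (auto simp: signs_def sign_of_def Int_assoc)

lemma signs_eqI: "s \<in> signs I P \<Longrightarrow> t \<in> signs I P \<Longrightarrow> (\<And>S. S \<subseteq> I \<Longrightarrow> s S = t S) \<Longrightarrow> s = t"
  using signs_Int by (metis ext inf_le2)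

text \<open>The differences of two unit vectors from one block serve as test vectors: a set that
  splits the block has a nonzero sum on a suitable one of them.\<close>

lemma transposition_in_Tvee:
  assumes "B \<in> P" "i \<in> B" "j \<in> B"
  shows "(\<lambda>k. of_bool (k = i) - of_bool (k = j)) \<in> Tvee I P"
proof -
  have fb: "\<And>B. B \<in> P \<Longrightarrow> finite B" using block_subset fin finite_subset by blast
  have "i \<in> S \<longleftrightarrow> j \<in> S" if "S \<in> P" for S
    using assms that same_block by metis
  then show ?thesis
    using assms block_subset fb
    by (auto simp: Tvee_def sum_subtractf sum.delta of_bool_def)
qed

end

end

lemma sum_transposition:
  assumes "finite S"
  shows "(\<Sum>k\<in>S. of_bool (k = i) - of_bool (k = j)) = (of_bool (i \<in> S) - of_bool (j \<in> S) :: real)"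
  using assms by (simp add: sum_subtractf of_bool_def sum.delta)

section \<open>Small perturbations and the breaking of ties\<close>

lemma perturbation_keeps_signs:
  fixes a b :: "'x \<Rightarrow> real"
  assumes "finite A"
  shows "\<forall>\<^sub>F e in at_right 0. \<forall>x\<in>A. a x \<noteq> 0 \<longrightarrow> sgn (a x + e * b x) = sgn (a x)"
proof -
  have "\<forall>\<^sub>F e in at_right 0. a x \<noteq> 0 \<longrightarrow> sgn (a x + e * b x) = sgn (a x)" for x
  proof (cases "a x = 0")
    case False
    have "((\<lambda>e. a x + e * b x) \<longlongrightarrow> a x + 0 * b x) (at_right 0)"
      by (intro tendsto_intros)
    then have *: "((\<lambda>e. a x + e * b x) \<longlongrightarrow> a x) (at_right 0)" by simp
    show ?thesis
    proof (cases "a x > 0")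
      case True
      show ?thesis using order_tendstoD(1)[OF * True]
        by eventually_elim (use True in auto)
    next
      case False
      with \<open>a x \<noteq> 0\<close> have neg: "a x < 0" by simp
      show ?thesis using order_tendstoD(2)[OF * neg]
        by eventually_elim (use neg in auto)
    qed
  qed auto
  then show ?thesis
    using assms by (intro eventually_ball_finite) auto
qed

lemma ex_positive_if_eventually:
  assumes "\<forall>\<^sub>F e in at_right (0::real). Q e"
  shows "\<exists>e>0. Q e"
proof -
  have "\<forall>\<^sub>F e in at_right (0::real). e > 0 \<and> Q e"
    using assms eventually_at_right_less[of 0] by eventually_elim auto
  from eventually_happens'[OF _ this] show ?thesis by auto
qed

text \<open>This is the sign function of a vector with signs \<open>s\<close> after an infinitesimal
  push that raises the first part of the cut and lowers the second. Where \<open>s\<close> vanishes,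
  the push decides; it cancels if \<open>S\<close> contains both parts or neither.\<close>

definition cut_sign :: "'a set \<times> 'a set \<Rightarrow> ('a set \<Rightarrow> real) \<Rightarrow> 'a set \<Rightarrow> real" where
  "cut_sign V s S = (if s S \<noteq> 0 then s S else of_bool (fst V \<subseteq> S) - of_bool (snd V \<subseteq> S))"

lemma signs_cases:
  assumes "s \<in> signs I P"
  obtains h where "generic I P h" "s = sign_of I h"
  using assms by (auto simp: signs_def)

lemma sum_perturbation:
  fixes h v :: "'a \<Rightarrow> real"
  shows "(\<Sum>i\<in>S. h i + e * v i) = sum h S + e * sum v S"
  by (simp add: sum.distrib sum_distrib_left)

lemma Tvee_perturbation:
  "h \<in> Tvee I P \<Longrightarrow> v \<in> Tvee I P \<Longrightarrow> (\<lambda>i. h i + e * v i) \<in> Tvee I P"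
  by (auto simp: Tvee_def sum_perturbation)

lemma subspace_Tvee: "fun_space.subspace (Tvee I P)"
  by (auto simp: fun_space.subspace_def Tvee_def fun_scale_def sum.distrib sum_distrib_left[symmetric])

section \<open>Adjoint faces and their sign functions\<close>

lemma open_face_through_eq:
  assumes "h \<in> Tvee I {I}"
  shows "open_face_through I h = face_of I (sign_of I h)"
proof -
  \<comment> \<open>\<open>open_face_through\<close> does not test the empty set and
    \<open>I\<close>, but both sums vanish there for vectors of \<open>Tvee I {I}\<close>.\<close>
  have "sgn (sum h' S) = sgn (sum h S)"
    if "h' \<in> Tvee I {I}" "\<forall>S. S \<noteq> {} \<and> S \<subset> I \<longrightarrow> sgn (sum h' S) = sgn (sum h S)" "S \<subseteq> I" for h' S
    using that assms by (cases "S = {} \<or> S = I") (auto simp: Tvee_def)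
  then show ?thesis
    by (auto simp: open_face_through_def face_of_def sign_of_eq_iff)
qed

context
  fixes I :: "'a set" and P :: "'a set set"
  assumes part: "partition_on I P" and fin: "finite I"
begin

lemma generic_whole: "generic I P h \<Longrightarrow> h \<in> Tvee I {I}"
  using Tvee_whole[OF part fin] by (simp add: generic_def)

lemma signs_nonempty_face:
  assumes "s \<in> signs I P"
  shows "face_of I s \<noteq> {}"
  using assms generic_whole by (auto simp: signs_def face_of_def)

lemma face_of_inject:
  assumes "s \<in> signs I P" "face_of I s = face_of I t"
  shows "s = t"
  using signs_nonempty_face[OF assms(1)] assms(2) by (auto simp: face_of_def)

lemma face_sign_face_of:
  assumes "s \<in> signs I P" "S \<subseteq> I"
  shows "face_sign (face_of I s) S = s S"
proof -
  obtain h where h: "h \<in> face_of I s" using signs_nonempty_face[OF assms(1)] by auto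
  have eq: "sgn (sum h' S) = s S" if "h' \<in> face_of I s" for h'
    using that assms(2) sign_of_subset[of S I h'] by (auto simp: face_of_def)
  show ?thesis
    unfolding face_sign_def
  proof (rule the_equality)
    show "\<forall>h\<in>face_of I s. sgn (sum h S) = s S" using eq by blast
    show "\<And>\<sigma>. \<forall>h\<in>face_of I s. sgn (sum h S) = \<sigma> \<Longrightarrow> \<sigma> = s S" using h eq by auto
  qed
qed

text \<open>A face is open in its support. Nonzero sums keep their sign for small \<open>e\<close>,
  and where the sum of \<open>h\<close> is zero the set is saturated, so the sum of \<open>v\<close>
  is zero too.\<close>

lemma generic_perturbation:
  assumes h: "generic I P h" and v: "v \<in> Tvee I P"
  shows "\<forall>\<^sub>F e in at_right 0. generic I P (\<lambda>i. h i + e * v i) \<and>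
    sign_of I (\<lambda>i. h i + e * v i) = sign_of I h"
proof -
  have "\<forall>\<^sub>F e in at_right 0. \<forall>S\<in>Pow I. sum h S \<noteq> 0 \<longrightarrow> sgn (sum h S + e * sum v S) = sgn (sum h S)"
    using perturbation_keeps_signs[of "Pow I" "sum h" "sum v"] fin by auto
  then show ?thesis
  proof eventually_elim
    case (elim e)
    have "sgn (sum h S + e * sum v S) = sgn (sum h S)" if S: "S \<subseteq> I" for S
    proof (cases "sum h S = 0")
      case True
      then have "sum v S = 0"
        using generic_zero_iff[OF part fin h S] Tvee_sum_saturated[OF part fin v S] by blast
      with True show ?thesis by simp
    qed (use elim S in auto)
    then have same: "sgn (\<Sum>i\<in>S. h i + e * v i) = sgn (sum h S)" if "S \<subseteq> I" for S
      using that by (simp add: sum_perturbation)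
    then have zero: "(\<Sum>i\<in>S. h i + e * v i) = 0 \<Longrightarrow> sum h S = 0" if "S \<subseteq> I" for S
      using that by (metis sgn_0_0)
    have "generic I P (\<lambda>i. h i + e * v i)"
      using h Tvee_perturbation[OF _ v, of h e] zero unfolding generic_def by blast
    with same show ?case by (auto simp: sign_of_eq_iff)
  qed
qed

text \<open>Zero block sums persist on the face, which bounds the span from above. Conversely any
  \<open>v\<close> in \<open>Tvee I P\<close> is a multiple of the difference of two points of the
  face, by a small move along \<open>v\<close>.\<close>

lemma span_face_of_generic:
  assumes h: "generic I P h"
  shows "fun_space.span (face_of I (sign_of I h)) = Tvee I P"
proof
  have "face_of I (sign_of I h) \<subseteq> Tvee I P"
  proof
    fix g assume g: "g \<in> face_of I (sign_of I h)"
    have "sum g B = 0" if B: "B \<in> P" for B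
    proof -
      have BI: "B \<subseteq> I" using block_subset[OF part B] .
      have "sgn (sum g B) = sgn (sum h B)"
        using g BI by (auto simp: face_of_def sign_of_eq_iff)
      moreover have "sum h B = 0" using h B by (auto simp: generic_def Tvee_def)
      ultimately show ?thesis by (simp add: sgn_0_0)
    qed
    then show "g \<in> Tvee I P" using g by (auto simp: face_of_def Tvee_def)
  qed
  then show "fun_space.span (face_of I (sign_of I h)) \<subseteq> Tvee I P"
    using fun_space.span_minimal subspace_Tvee by blast
  show "Tvee I P \<subseteq> fun_space.span (face_of I (sign_of I h))"
  proof
    fix v assume "v \<in> Tvee I P"
    then obtain e where e: "e > 0" "generic I P (\<lambda>i. h i + e * v i)"
      "sign_of I (\<lambda>i. h i + e * v i) = sign_of I h"
      using ex_positive_if_eventually[OF generic_perturbation[OF h]] by blast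
    have "(\<lambda>i. h i + e * v i) \<in> face_of I (sign_of I h)" "h \<in> face_of I (sign_of I h)"
      using e generic_whole h by (auto simp: face_of_def)
    then have "fun_scale (1/e) ((\<lambda>i. h i + e * v i) - h) \<in> fun_space.span (face_of I (sign_of I h))"
      by (intro fun_space.span_scale fun_space.span_diff fun_space.span_base)
    moreover have "fun_scale (1/e) ((\<lambda>i. h i + e * v i) - h) = v"
      using e by (auto simp: fun_scale_def)
    ultimately show "v \<in> fun_space.span (face_of I (sign_of I h))" by simp
  qed
qed

text \<open>If the sum over \<open>S\<close> vanishes at \<open>h\<close>, it vanishes on the whole
  face and hence on its span \<open>Tvee I P\<close>. A block split by \<open>S\<close> would supply
  a test vector on which it does not.\<close>

lemma generic_if_span_face:
  assumes h: "h \<in> Tvee I {I}" and span: "fun_space.span (face_of I (sign_of I h)) = Tvee I P"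
  shows "generic I P h"
  unfolding generic_def
proof (intro conjI allI impI)
  have hX: "h \<in> face_of I (sign_of I h)" using h by (simp add: face_of_def)
  then show "h \<in> Tvee I P" using fun_space.span_base span by blast
  fix S assume S: "S \<subseteq> I" and 0: "sum h S = 0"
  have sub: "fun_space.subspace {v :: 'a \<Rightarrow> real. sum v S = 0}"
    by (auto simp: fun_space.subspace_def fun_scale_def sum.distrib sum_distrib_left[symmetric])
  have "face_of I (sign_of I h) \<subseteq> {v. sum v S = 0}"
  proof clarify
    fix g assume "g \<in> face_of I (sign_of I h)"
    then have "sgn (sum g S) = sgn (sum h S)" using S by (auto simp: face_of_def sign_of_eq_iff)
    with 0 show "sum g S = 0" by (simp add: sgn_0_0)
  qed
  then have T: "Tvee I P \<subseteq> {v. sum v S = 0}"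
    using fun_space.span_minimal[OF _ sub] span by blast
  show "saturated P S"
  proof (rule ccontr)
    assume "\<not> saturated P S"
    then obtain B i j where B: "B \<in> P" "i \<in> B" "i \<in> S" "j \<in> B" "j \<notin> S"
      unfolding saturated_def by blast
    then have "(\<Sum>k\<in>S. of_bool (k = i) - of_bool (k = j)) = (0::real)"
      using T transposition_in_Tvee[OF part fin, of B i j] by blast
    with B sum_transposition[OF finite_subset[OF S fin], of i j] show False by simp
  qed
qed

lemma adjoint_faces_eq: "adjoint_faces I P = face_of I ` signs I P"
proof
  show "adjoint_faces I P \<subseteq> face_of I ` signs I P"
    using generic_if_span_face open_face_through_eq
    by (fastforce simp: adjoint_faces_def signs_def)
  show "face_of I ` signs I P \<subseteq> adjoint_faces I P"
    using generic_whole span_face_of_generic open_face_through_eq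
    by (fastforce simp: adjoint_faces_def signs_def)
qed

lemma signs_trivial:
  assumes "s \<in> signs I P"
  shows "s {} = 0" "s I = 0"
  using signs_zero_iff[OF part fin assms] block_subset[OF part]
  by (auto simp: saturated_def)

text \<open>This evaluates the definite description behind restriction and cutting. Agreement on
  proper nonempty subsets suffices because all sign functions vanish at the empty set and at
  \<open>I\<close>.\<close>

lemma face_with_sign_eq:
  assumes s: "s \<in> signs I P" and g: "\<And>S. S \<noteq> {} \<Longrightarrow> S \<subset> I \<Longrightarrow> g S = s S"
  shows "face_with_sign I P g = face_of I s"
  unfolding face_with_sign_def
proof (rule the_equality)
  show "face_of I s \<in> adjoint_faces I P \<and>
      (\<forall>S. S \<noteq> {} \<and> S \<subset> I \<longrightarrow> face_sign (face_of I s) S = g S)"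
    using s g face_sign_face_of[OF s] by (auto simp: adjoint_faces_eq)
  fix X assume X: "X \<in> adjoint_faces I P \<and> (\<forall>S. S \<noteq> {} \<and> S \<subset> I \<longrightarrow> face_sign X S = g S)"
  then obtain t where t: "t \<in> signs I P" "X = face_of I t" by (auto simp: adjoint_faces_eq)
  have "t S = s S" if "S \<subseteq> I" for S
  proof (cases "S = {} \<or> S = I")
    case False
    with that have "S \<noteq> {}" "S \<subset> I" by auto
    with X t g face_sign_face_of[OF t(1) that] show ?thesis by auto
  qed (use signs_trivial[OF s] signs_trivial[OF t(1)] in auto)
  then show "X = face_of I s" using signs_eqI[OF part fin t(1) s] t(2) by blast
qed

end

section \<open>Restriction to a block and cuts, in terms of signs\<close>

lemma partition_on_block_partition:
  assumes "S \<subseteq> I" "S \<noteq> {}"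
  shows "partition_on I (block_partition I S)"
  using assms by (auto simp: partition_on_def block_partition_def disjoint_def)

lemma partition_on_cut_partition:
  assumes "partition_on I P" "is_cut P V"
  shows "partition_on I (cut_partition P V)"
proof -
  obtain C D where [simp]: "V = (C, D)" by (cases V)
  have V: "C \<noteq> {}" "D \<noteq> {}" "C \<inter> D = {}" "C \<union> D \<in> P" using assms by auto
  have dis: "B \<inter> C = {} \<and> B \<inter> D = {}" if "B \<in> P" "B \<noteq> C \<union> D" for B
    using same_block[OF assms(1) that(1) V(4)] that by blast
  show ?thesis
  proof (rule partition_onI)
    show "\<Union>(cut_partition P V) = I"
      using V partition_onD1[OF assms(1)] by auto
    show "{} \<notin> cut_partition P V"
      using V partition_onD3[OF assms(1)] by auto
    fix p q assume "p \<in> cut_partition P V" "q \<in> cut_partition P V" "p \<noteq> q"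
    then have "p = C \<or> p = D \<or> p \<in> P \<and> p \<noteq> C \<union> D" "q = C \<or> q = D \<or> q \<in> P \<and> q \<noteq> C \<union> D" "p \<noteq> q"
      by auto
    moreover have "disjnt p q" if "p \<in> P" "q \<in> P" "p \<noteq> q" for p q
      using same_block[OF assms(1) that(1,2)] that(3) by (auto simp: disjnt_def)
    ultimately show "disjnt p q"
      using dis V(3) by (metis disjnt_def disjnt_sym)
  qed
qed

context
  fixes I :: "'a set" and P :: "'a set set"
  assumes part: "partition_on I P" and fin: "finite I"
begin

lemma restrict_signs:
  assumes s: "s \<in> signs I P" and B: "B \<in> P"
  shows "(\<lambda>E. s (E \<inter> B)) \<in> signs I (block_partition I B)"
    and "restrict_face I B (face_of I s) = face_of I (\<lambda>E. s (E \<inter> B))"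
proof -
  obtain h where h: "generic I P h" "s = sign_of I h" using s by (rule signs_cases)
  have BI: "B \<subseteq> I" "B \<noteq> {}" using block_subset[OF part B] part B by (auto simp: partition_on_def)
  \<comment> \<open>The restricted face is realised by setting \<open>h\<close> to zero outside
    \<open>B\<close>.\<close>
  let ?h = "\<lambda>i. if i \<in> B then h i else 0"
  have sum: "sum ?h E = sum h (E \<inter> B)" if "E \<subseteq> I" for E
    using finite_subset[OF that fin] by (simp add: sum.inter_restrict)
  have sums: "sum h {} = 0" "sum h B = 0"
    using h B by (auto simp: generic_def Tvee_def)
  have "?h \<in> Tvee I (block_partition I B)"
    using sum[of B] sums BI by (auto simp: Tvee_def block_partition_def)
  moreover have "saturated (block_partition I B) E" if "E \<subseteq> I" "sum ?h E = 0" for E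
  proof -
    have "saturated P (E \<inter> B)"
      using that sum[OF that(1)] h(1) unfolding generic_def by (metis inf.coboundedI1)
    with B show ?thesis by (auto simp: saturated_def block_partition_def)
  qed
  ultimately have gen: "generic I (block_partition I B) ?h" by (simp add: generic_def)
  have "sign_of I ?h = (\<lambda>E. s (E \<inter> B))"
  proof
    fix E
    show "sign_of I ?h E = s (E \<inter> B)"
      using sum[of "E \<inter> I"] by (simp add: sign_of_def h(2) Int_ac)
  qed
  then show mem: "(\<lambda>E. s (E \<inter> B)) \<in> signs I (block_partition I B)"
    using gen by (force simp: signs_def)
  have "s {} = 0" using signs_trivial[OF part fin s] by simp
  then show "restrict_face I B (face_of I s) = face_of I (\<lambda>E. s (E \<inter> B))"
    unfolding restrict_face_def
    using face_with_sign_eq[OF partition_on_block_partition[OF BI] fin mem]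
      face_sign_face_of[OF part fin s] BI
    by (smt (verit, best) inf.coboundedI2)
qed

lemma saturated_cut_partition_iff:
  assumes "is_cut P (C, D)"
  shows "saturated P S \<longleftrightarrow> saturated (cut_partition P (C, D)) S \<and> (C \<subseteq> S \<longleftrightarrow> D \<subseteq> S)"
proof -
  define K where "K \<longleftrightarrow> (\<forall>B\<in>P - {C \<union> D}. B \<subseteq> S \<or> B \<inter> S = {})"
  have CD: "C \<noteq> {}" "D \<noteq> {}" "C \<union> D \<in> P" using assms by auto
  have 1: "saturated P S \<longleftrightarrow> K \<and> (C \<union> D \<subseteq> S \<or> (C \<union> D) \<inter> S = {})"
    using CD(3) by (auto simp: saturated_def K_def)
  have 2: "saturated (cut_partition P (C, D)) S \<longleftrightarrow>
      K \<and> (C \<subseteq> S \<or> C \<inter> S = {}) \<and> (D \<subseteq> S \<or> D \<inter> S = {})"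
    by (auto simp: saturated_def K_def)
  show ?thesis unfolding 1 2 using CD(1,2) by blast
qed

text \<open>This identifies the first clause in the definition of \<open>cut_face\<close> with a tie
  of a face over the finer partition that \<open>cut_sign\<close> resolves to +1.\<close>

lemma eq_mod_cut_iff:
  assumes V: "is_cut P (C, D)" and S: "S \<subseteq> I"
  shows "eq_mod P S C \<longleftrightarrow> saturated (cut_partition P (C, D)) S \<and> C \<subseteq> S \<and> \<not> D \<subseteq> S"
proof -
  have V': "C \<noteq> {}" "D \<noteq> {}" "C \<inter> D = {}" "C \<union> D \<in> P" using V by auto
  have CI: "C \<subseteq> I" using block_subset[OF part V'(4)] by auto
  have "\<not> C \<union> D \<subseteq> C" using V' by auto
  then have "C \<subseteq> Redn P C" using Redn_iff[OF part CI] V'(4) by blast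
  then have C: "Redn P C = C" using Redn_subset[of P C] by auto
  have other: "B \<inter> C = {} \<and> B \<inter> D = {}" if "B \<in> P" "B \<noteq> C \<union> D" for B
    using same_block[OF part that(1) V'(4)] that by blast
  show ?thesis
  proof
    assume "eq_mod P S C"
    then have R: "Redn P S = C" using C by (simp add: eq_mod_def)
    have CS: "C \<subseteq> S" using R Redn_subset[of P S] by blast
    \<comment> \<open>A point of \<open>D\<close> in \<open>S\<close> lies outside
      \<open>Redn P S\<close>, so its whole block \<open>C \<union> D\<close> would lie in
      \<open>S\<close>; then the points of \<open>C\<close> would have been removed as well.\<close>
    have D: "d \<notin> S" if d: "d \<in> D" for d
    proof
      assume "d \<in> S"
      then have "C \<union> D \<subseteq> S" using R Redn_iff[OF part S, of d] V' d by blast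
      moreover obtain c where c: "c \<in> C" using V' by blast
      ultimately show False
        using R Redn_iff[OF part S, of c] same_block[OF part _ V'(4), of _ c] by blast
    qed
    have "B \<subseteq> S \<or> B \<inter> S = {}" if B: "B \<in> P" "B \<noteq> C \<union> D" for B
      using other[OF B] R Redn_iff[OF part S] B(1) by blast
    with CS D V' show "saturated (cut_partition P (C, D)) S \<and> C \<subseteq> S \<and> \<not> D \<subseteq> S"
      by (auto simp: saturated_def)
  next
    assume *: "saturated (cut_partition P (C, D)) S \<and> C \<subseteq> S \<and> \<not> D \<subseteq> S"
    then have D: "D \<inter> S = {}" by (auto simp: saturated_def)
    have "x \<in> Redn P S \<longleftrightarrow> x \<in> C" for x
    proof
      assume "x \<in> Redn P S"
      then obtain B where B: "x \<in> S" "B \<in> P" "x \<in> B" "\<not> B \<subseteq> S"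
        using Redn_iff[OF part S] by blast
      have "B = C \<union> D"
        using * B by (fastforce simp: saturated_def)
      with B D show "x \<in> C" by auto
    next
      assume "x \<in> C"
      with * V' D show "x \<in> Redn P S" using Redn_iff[OF part S, of x] by blast
    qed
    then show "eq_mod P S C" using C by (auto simp: eq_mod_def)
  qed
qed

lemma cut_sign_in_signs:
  assumes V: "is_cut P V" and s: "s \<in> signs I (cut_partition P V)"
  shows "cut_sign V s \<in> signs I P"
proof -
  obtain C D where CD: "V = (C, D)" by (cases V)
  let ?Q = "cut_partition P V"
  note partQ = partition_on_cut_partition[OF part V]
  obtain h where h: "generic I ?Q h" "s = sign_of I h" using s by (rule signs_cases)
  have V': "C \<noteq> {}" "D \<noteq> {}" "C \<inter> D = {}" "C \<union> D \<in> P" using V CD by auto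
  have CDI: "C \<subseteq> I" "D \<subseteq> I" using block_subset[OF part V'(4)] by auto
  obtain c d where cd: "c \<in> C" "d \<in> D" using V' by blast
  \<comment> \<open>Raise one point of \<open>C\<close> and lower one point of \<open>D\<close>. A
    tie \<open>S\<close> of \<open>h\<close> is saturated for the finer partition, so it contains
    \<open>c\<close> iff it contains \<open>C\<close>, and likewise for \<open>d\<close> and
    \<open>D\<close>; the tie is therefore broken as \<open>cut_sign\<close> prescribes.\<close>
  define v :: "'a \<Rightarrow> real" where "v = (\<lambda>k. of_bool (k = c) - of_bool (k = d))"
  obtain e where e: "e > 0" "\<And>S. S \<subseteq> I \<Longrightarrow> sum h S \<noteq> 0 \<Longrightarrow> sgn (sum h S + e * sum v S) = sgn (sum h S)"
    using ex_positive_if_eventually[OF perturbation_keeps_signs[of "Pow I" "sum h" "sum v"]] fin by auto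
  let ?g = "\<lambda>i. h i + e * v i"
  have v: "sum v S = of_bool (C \<subseteq> S) - of_bool (D \<subseteq> S)" if "S \<subseteq> I" "sum h S = 0" for S
  proof -
    have "saturated ?Q S" using that h by (simp add: generic_def)
    then have "c \<in> S \<longleftrightarrow> C \<subseteq> S" "d \<in> S \<longleftrightarrow> D \<subseteq> S"
      using cd CD by (auto simp: saturated_def)
    then show ?thesis
      unfolding v_def using sum_transposition[OF finite_subset[OF that(1) fin]] by simp
  qed
  have g: "sgn (sum ?g S) = cut_sign V s S" if S: "S \<subseteq> I" for S
  proof (cases "sum h S = 0")
    case True
    with v[OF S] e(1) show ?thesis
      using S by (auto simp: sum_perturbation cut_sign_def h(2) sign_of_subset CD sgn_mult)
  next
    case False
    with e S show ?thesis
      by (auto simp: sum_perturbation cut_sign_def h(2) sign_of_subset sgn_0_0)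
  qed
  have "h \<in> Tvee I P"
  proof -
    have hQ: "h \<in> Tvee I ?Q" using h by (simp add: generic_def)
    have "sum h B = 0" if "B \<in> P" for B
      using Tvee_sum_saturated[OF partQ fin hQ block_subset[OF part that]]
        saturated_cut_partition_iff[of C D B] V CD same_block[OF part that]
      unfolding saturated_def by blast
    with hQ show ?thesis by (auto simp: Tvee_def)
  qed
  moreover have "v \<in> Tvee I P"
    unfolding v_def using transposition_in_Tvee[OF part fin V'(4)] cd by simp
  moreover have "saturated P S" if S: "S \<subseteq> I" "sum ?g S = 0" for S
  proof -
    have "cut_sign V s S = 0" using g[OF S(1)] S(2) by simp
    then have "s S = 0" "C \<subseteq> S \<longleftrightarrow> D \<subseteq> S" by (auto simp: cut_sign_def CD split: if_splits)
    then show ?thesis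
      using saturated_cut_partition_iff[of C D S] V CD signs_zero_iff[OF partQ fin s S(1)] by simp
  qed
  ultimately have gen: "generic I P ?g" using Tvee_perturbation by (auto simp: generic_def)
  have "sign_of I ?g = cut_sign V s"
  proof
    fix S
    have "C \<subseteq> S \<inter> I \<longleftrightarrow> C \<subseteq> S" "D \<subseteq> S \<inter> I \<longleftrightarrow> D \<subseteq> S" using CDI by auto
    then have "cut_sign V s (S \<inter> I) = cut_sign V s S"
      using signs_Int[OF partQ fin s] by (simp add: cut_sign_def CD)
    then show "sign_of I ?g S = cut_sign V s S" using g[of "S \<inter> I"] by (simp add: sign_of_def)
  qed
  then show ?thesis using gen by (force simp: signs_def)
qed

lemma cut_face_face_of:
  assumes V: "is_cut P V" and s: "s \<in> signs I (cut_partition P V)"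
  shows "cut_face I P V (face_of I s) = face_of I (cut_sign V s)"
proof -
  obtain C D where CD: "V = (C, D)" by (cases V)
  have V': "is_cut P (C, D)" "is_cut P (D, C)" "cut_partition P (D, C) = cut_partition P (C, D)"
    using V CD by (auto simp: Un_commute Int_commute)
  note partQ = partition_on_cut_partition[OF part V]
  show ?thesis
    unfolding CD cut_face.simps
  proof (rule face_with_sign_eq[OF part fin])
    show "cut_sign (C, D) s \<in> signs I P" using cut_sign_in_signs[OF V s] CD by simp
    fix S assume "S \<noteq> {}" "S \<subset> I"
    then have S: "S \<subseteq> I" by simp
    show "(if eq_mod P S C then 1 else if eq_mod P S D then - 1
        else if \<not> eq_mod (cut_partition P (C, D)) S {} then face_sign (face_of I s) S else 0) =
        cut_sign (C, D) s S"
      using eq_mod_cut_iff[OF V'(1) S] eq_mod_cut_iff[OF V'(2) S] V'(3)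
        eq_mod_empty_iff[OF partQ S] face_sign_face_of[OF partQ fin s S]
        signs_zero_iff[OF partQ fin s S] CD
      by (auto simp: cut_sign_def)
  qed
qed

end

section \<open>Semisimplicity as locality in the blocks\<close>

text \<open>For members of \<open>signs I P\<close> this means that the faces have the same
  restriction to every block (\<open>restrict_face_eq_iff\<close>).\<close>

definition block_agree :: "'a set set \<Rightarrow> ('a set \<Rightarrow> real) \<Rightarrow> ('a set \<Rightarrow> real) \<Rightarrow> bool" where
  "block_agree P s t \<longleftrightarrow> (\<forall>B\<in>P. \<forall>S\<subseteq>B. s S = t S)"

definition block_local :: "'a set \<Rightarrow> 'a set set \<Rightarrow> (('a set \<Rightarrow> real) \<Rightarrow> 'k) \<Rightarrow> bool" where
  "block_local I P F \<longleftrightarrow>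
     (\<forall>s\<in>signs I P. \<forall>t\<in>signs I P. block_agree P s t \<longrightarrow> F s = F t)"

lemma sum_fun_apply: "(\<Sum>a\<in>A. F a) x = (\<Sum>a\<in>A. F a x)"
  by (induction A rule: infinite_finite_induct) auto

context
  fixes I :: "'a set" and P :: "'a set set"
  assumes part: "partition_on I P" and fin: "finite I"
begin

text \<open>Values are -1, 0 or 1, so a sign function is determined by the two families of subsets
  where it is 1 and where it is -1. Finiteness makes the expansion into indicators below a finite
  sum.\<close>

lemma finite_signs: "finite (signs I P)"
proof (rule inj_on_finite)
  let ?c = "\<lambda>s. ({S. S \<subseteq> I \<and> s S = 1}, {S. S \<subseteq> I \<and> s S = -1})"
  show "inj_on ?c (signs I P)"
  proof
    fix s t assume st: "s \<in> signs I P" "t \<in> signs I P" "?c s = ?c t"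
    show "s = t"
    proof (rule signs_eqI[OF part fin st(1,2)])
      fix S assume S: "S \<subseteq> I"
      have "sgn x \<in> {-1, 0, 1}" for x :: real by (simp add: sgn_real_def)
      then have "s S \<in> {-1, 0, 1}" "t S \<in> {-1, 0, 1}"
        using st(1,2) unfolding signs_def sign_of_def by blast+
      moreover have "s S = 1 \<longleftrightarrow> t S = 1" "s S = -1 \<longleftrightarrow> t S = -1" using st(3) S by auto
      ultimately show "s S = t S" by auto
    qed
  qed
  show "?c ` signs I P \<subseteq> Pow (Pow I) \<times> Pow (Pow I)" by auto
  show "finite (Pow (Pow I) \<times> Pow (Pow I))" using fin by auto
qed

lemma restrict_face_eq_iff:
  assumes s: "s \<in> signs I P" and t: "t \<in> signs I P" and B: "B \<in> P"
  shows "restrict_face I B (face_of I s) = restrict_face I B (face_of I t) \<longleftrightarrow> (\<forall>S\<subseteq>B. s S = t S)"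
proof
  have BI: "B \<subseteq> I" "B \<noteq> {}"
    using block_subset[OF part B] part B by (auto simp: partition_on_def)
  assume "restrict_face I B (face_of I s) = restrict_face I B (face_of I t)"
  then have "(\<lambda>E. s (E \<inter> B)) = (\<lambda>E. t (E \<inter> B))"
    using restrict_signs[OF part fin s B] restrict_signs[OF part fin t B]
      face_of_inject[OF partition_on_block_partition[OF BI] fin] by metis
  then show "\<forall>S\<subseteq>B. s S = t S" by (metis Int_absorb2)
next
  assume "\<forall>S\<subseteq>B. s S = t S"
  then have "(\<lambda>E. s (E \<inter> B)) = (\<lambda>E. t (E \<inter> B))" by auto
  then show "restrict_face I B (face_of I s) = restrict_face I B (face_of I t)"
    using restrict_signs[OF part fin s B] restrict_signs[OF part fin t B] by metis
qed

text \<open>The functionals with local values form a subspace, and it contains the pure tensors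
  because these see a face only through its restrictions.\<close>

lemma block_local_if_semisimple:
  fixes f :: "('a \<Rightarrow> real) set \<Rightarrow> 'k::field"
  assumes "semisimple I P f"
  shows "block_local I P (\<lambda>s. f (face_of I s))"
proof -
  let ?W = "{f :: ('a \<Rightarrow> real) set \<Rightarrow> 'k. block_local I P (\<lambda>s. f (face_of I s))}"
  have "fun_space.subspace ?W"
    unfolding fun_space.subspace_def by (auto simp: block_local_def fun_scale_def)
  moreover have "prod_functional I P g (face_of I s) = prod_functional I P g (face_of I t)"
    if st: "s \<in> signs I P" "t \<in> signs I P" "block_agree P s t" for g :: "_ \<Rightarrow> _ \<Rightarrow> 'k" and s t
    using st adjoint_faces_eq[OF part fin] restrict_face_eq_iff[OF st(1,2)]
    by (auto simp: prod_functional_def block_agree_def intro!: prod.cong)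
  then have "{prod_functional I P g | g. \<forall>S\<in>P. g S \<in> functionals I (block_partition I S)} \<subseteq> ?W"
    unfolding block_local_def by blast
  ultimately show ?thesis
    using fun_space.span_minimal assms unfolding semisimple_def by blast
qed

text \<open>A local \<open>f\<close> is constant on the faces with a given tuple of restrictions.
  The indicator of such a class is a pure tensor of indicators, and \<open>f\<close> is a linear
  combination of these.\<close>

lemma semisimple_if_block_local:
  fixes f :: "('a \<Rightarrow> real) set \<Rightarrow> 'k::field"
  assumes f: "f \<in> functionals I P" and loc: "block_local I P (\<lambda>s. f (face_of I s))"
  shows "semisimple I P f"
proof -
  let ?A = "adjoint_faces I P"
  \<comment> \<open>The tuple of restrictions of a face. The constant default off \<open>P\<close>
    makes equality of tuples the same as equality on the blocks.\<close>
  define r where "r X = (\<lambda>B. if B \<in> P then restrict_face I B X else {})" for X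
  define g :: "('a set \<Rightarrow> ('a \<Rightarrow> real) set) \<Rightarrow> 'a set \<Rightarrow> ('a \<Rightarrow> real) set \<Rightarrow> 'k"
    where "g \<rho> B X = of_bool (X = \<rho> B)" for \<rho> B X
  have finP: "finite P" using fin part finite_elements by blast
  have finA: "finite ?A" using finite_signs by (simp add: adjoint_faces_eq[OF part fin])
  have same: "f X = f Y" if XY: "X \<in> ?A" "Y \<in> ?A" "r X = r Y" for X Y
  proof -
    obtain s t where st: "s \<in> signs I P" "t \<in> signs I P" "X = face_of I s" "Y = face_of I t"
      using XY by (auto simp: adjoint_faces_eq[OF part fin])
    have "restrict_face I B X = restrict_face I B Y" if "B \<in> P" for B
      using fun_cong[OF XY(3), of B] that by (simp add: r_def)
    then have "block_agree P s t"
      using restrict_face_eq_iff[OF st(1,2)] st(3,4) by (simp add: block_agree_def)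
    with loc st show ?thesis by (auto simp: block_local_def)
  qed
  have pf: "prod_functional I P (g \<rho>) X = of_bool (r X = \<rho>)" if "X \<in> ?A" "\<rho> \<in> r ` ?A" for X \<rho>
  proof -
    have "r X = \<rho> \<longleftrightarrow> (\<forall>B\<in>P. restrict_face I B X = \<rho> B)"
      using that(2) by (auto simp: r_def fun_eq_iff)
    with that(1) show ?thesis
      by (cases "r X = \<rho>") (auto simp: prod_functional_def g_def finP intro!: prod.neutral prod_zero)
  qed
  \<comment> \<open>\<open>inv_into\<close> picks one face for each tuple; by \<open>same\<close>
    its value is the common value of \<open>f\<close> on the class.\<close>
  have "f = (\<Sum>\<rho>\<in>r ` ?A. fun_scale (f (inv_into ?A r \<rho>)) (prod_functional I P (g \<rho>)))" (is "f = ?R")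
  proof
    fix X
    show "f X = ?R X"
    proof (cases "X \<in> ?A")
      case True
      have "?R X = (\<Sum>\<rho>\<in>r ` ?A. if \<rho> = r X then f (inv_into ?A r \<rho>) else 0)"
        unfolding sum_fun_apply by (intro sum.cong) (auto simp: fun_scale_def pf[OF True])
      also have "\<dots> = f (inv_into ?A r (r X))"
        using finA True by (subst sum.delta) auto
      also have "\<dots> = f X"
        using True by (intro same) (auto intro: inv_into_into f_inv_into_f)
      finally show ?thesis by simp
    next
      case False
      with f show ?thesis by (simp add: functionals_def sum_fun_apply fun_scale_def prod_functional_def)
    qed
  qed
  moreover have "g \<rho> B \<in> functionals I (block_partition I B)" if r: "\<rho> \<in> r ` ?A" and B: "B \<in> P" for \<rho> B
  proof -
    obtain X where X: "X \<in> ?A" "\<rho> = r X" using r by blast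
    then obtain s where s: "s \<in> signs I P" "X = face_of I s"
      by (auto simp: adjoint_faces_eq[OF part fin])
    have BI: "B \<subseteq> I" "B \<noteq> {}"
      using block_subset[OF part B] part B by (auto simp: partition_on_def)
    have "\<rho> B \<in> adjoint_faces I (block_partition I B)"
      using restrict_signs[OF part fin s(1) B] s(2) X(2) B
      by (simp add: adjoint_faces_eq[OF partition_on_block_partition[OF BI] fin] r_def)
    then show ?thesis by (auto simp: functionals_def g_def)
  qed
  then have "?R \<in> fun_space.span
      {prod_functional I P g | g. \<forall>S\<in>P. g S \<in> functionals I (block_partition I S)}"
    by (intro fun_space.span_sum fun_space.span_scale fun_space.span_base) blast
  ultimately show ?thesis unfolding semisimple_def by metis
qed

end

section \<open>Steinmann adjacency and wall crossing\<close>

definition sign_adjacent :: "'a set \<Rightarrow> 'a set set \<Rightarrow> ('a set \<Rightarrow> real) \<Rightarrow> ('a set \<Rightarrow> real) \<Rightarrow> bool" where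
  "sign_adjacent I P s t \<longleftrightarrow>
     (\<exists>E. E \<subset> I \<and> \<not> eq_mod P E {} \<and> \<not> semisimple_subset P E \<and>
        (\<forall>S\<subseteq>I. s S \<noteq> t S \<longrightarrow> eq_mod P S E \<or> eq_mod P S (I - E)))"

lemma sgn_convex_combination:
  assumes "sgn a = sgn b" "0 < t" "t < (1::real)"
  shows "sgn (a + t * (b - a)) = sgn b"
proof -
  have *: "a + t * (b - a) = (1 - t) * a + t * b" by (simp add: algebra_simps)
  consider "b = 0" "a = 0" | "b > 0" "a > 0" | "b < 0" "a < 0"
    using assms(1) by (auto simp: sgn_real_def split: if_splits)
  then show ?thesis
  proof cases
    case 2
    with assms have "(1 - t) * a + t * b > 0" by (intro add_pos_pos) auto
    with 2 show ?thesis unfolding * by simp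
  next
    case 3
    with assms have "(1 - t) * a + t * b < 0"
      by (intro add_neg_neg) (auto simp: mult_pos_neg)
    with 3 show ?thesis unfolding * by simp
  qed simp
qed

text \<open>The quotient is the time at which the segment from \<open>a\<close> to \<open>b\<close>
  passes through zero.\<close>

lemma sgn_segment:
  assumes "a * b < 0"
  shows "a / (a - b) < t \<Longrightarrow> sgn (a + t * (b - a)) = sgn (b :: real)"
    and "t < a / (a - b) \<Longrightarrow> sgn (a + t * (b - a)) = sgn a"
    and "0 < a / (a - b)" and "a / (a - b) < 1"
proof -
  have cs: "(a > 0 \<and> b < 0) \<or> (a < 0 \<and> b > 0)" using assms by (auto simp: mult_less_0_iff)
  show "a / (a - b) < t \<Longrightarrow> sgn (a + t * (b - a)) = sgn b"
    using cs by (auto simp: field_simps)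
  show "t < a / (a - b) \<Longrightarrow> sgn (a + t * (b - a)) = sgn a"
    using cs by (auto simp: field_simps)
  show "0 < a / (a - b)"
    using cs by (auto simp: field_simps zero_less_divide_iff)
  show "a / (a - b) < 1"
    using cs by (auto simp: field_simps)
qed

context
  fixes I :: "'a set" and P :: "'a set set"
  assumes part: "partition_on I P" and fin: "finite I"
begin

text \<open>Induct on \<open>K\<close>: if the new form vanishes at the current point, move slightly
  along a vector where it does not. A small enough step preserves the signs of the point and of the
  forms treated before.\<close>

lemma generic_avoiding_hyperplanes:
  assumes h: "generic I P h" and K: "finite K" "\<And>k. k \<in> K \<Longrightarrow> \<exists>v\<in>Tvee I P. L k v \<noteq> 0"
    and lin: "\<And>k g v e. L k (\<lambda>i. g i + e * v i) = L k g + (e :: real) * L k v"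
  shows "\<exists>g. generic I P g \<and> sign_of I g = sign_of I h \<and> (\<forall>k\<in>K. L k g \<noteq> 0)"
  using K
proof (induction K)
  case empty
  with h show ?case by auto
next
  case (insert k K)
  then obtain g where g: "generic I P g" "sign_of I g = sign_of I h" "\<forall>k\<in>K. L k g \<noteq> 0"
    by auto
  obtain v where v: "v \<in> Tvee I P" "L k v \<noteq> 0" using insert.prems by blast
  show ?case
  proof (cases "L k g = 0")
    case True
    have "\<forall>\<^sub>F e in at_right 0. \<forall>k\<in>K. L k g \<noteq> 0 \<longrightarrow> sgn (L k g + e * L k v) = sgn (L k g)"
      by (rule perturbation_keeps_signs[OF insert.hyps(1)])
    with generic_perturbation[OF part fin g(1) v(1)]
    have "\<forall>\<^sub>F e in at_right 0. (generic I P (\<lambda>i. g i + e * v i) \<and>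
        sign_of I (\<lambda>i. g i + e * v i) = sign_of I g) \<and>
        (\<forall>k\<in>K. L k g \<noteq> 0 \<longrightarrow> sgn (L k g + e * L k v) = sgn (L k g))"
      by (rule eventually_conj)
    then obtain e where e: "e > 0" "generic I P (\<lambda>i. g i + e * v i)"
        "sign_of I (\<lambda>i. g i + e * v i) = sign_of I g"
        "\<forall>k\<in>K. L k g \<noteq> 0 \<longrightarrow> sgn (L k g + e * L k v) = sgn (L k g)"
      using ex_positive_if_eventually by blast
    have "L k' (\<lambda>i. g i + e * v i) \<noteq> 0" if "k' \<in> insert k K" for k'
    proof (cases "k' = k")
      case True
      with \<open>L k g = 0\<close> v e(1) show ?thesis by (simp add: lin)
    next
      case False
      with that g(3) e(4) show ?thesis by (metis lin insertE sgn_0_0)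
    qed
    with e g(2) show ?thesis by metis
  next
    case False
    with g show ?thesis by auto
  qed
qed

text \<open>The reduction of a set depends only on which pairs of points of a common block the set
  separates.\<close>

lemma eq_modI:
  assumes "S \<subseteq> I" "T \<subseteq> I" "\<And>B i j. B \<in> P \<Longrightarrow> i \<in> B \<Longrightarrow> j \<in> B \<Longrightarrow> i \<in> S \<and> j \<notin> S \<longleftrightarrow> i \<in> T \<and> j \<notin> T"
  shows "eq_mod P S T"
proof -
  have "x \<in> Redn P S \<longleftrightarrow> x \<in> Redn P T" for x
    using Redn_iff[OF part assms(1), of x] Redn_iff[OF part assms(2), of x] assms(3) by blast
  then show ?thesis by (auto simp: eq_mod_def)
qed

text \<open>On the test vectors both sums take values in -1, 0 and 1, so the factors agree up to
  sign. Equal factors make both sets separate the same ordered pairs within blocks; opposite factors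
  reverse the pairs, which gives the complement.\<close>

lemma proportional_forms_eq_mod:
  assumes S: "S \<subseteq> I" "\<not> saturated P S" and T: "T \<subseteq> I" and ab: "a \<noteq> 0" "b \<noteq> 0"
    and lin: "\<And>v. v \<in> Tvee I P \<Longrightarrow> a * sum v T = (b :: real) * sum v S"
  shows "eq_mod P T S \<or> eq_mod P T (I - S)"
proof -
  have eq: "a * (of_bool (i \<in> T) - of_bool (j \<in> T)) = b * (of_bool (i \<in> S) - of_bool (j \<in> S))"
    if "B \<in> P" "i \<in> B" "j \<in> B" for B i j
    using lin[OF transposition_in_Tvee[OF part fin that]]
      sum_transposition[OF finite_subset[OF S(1) fin], of i j]
      sum_transposition[OF finite_subset[OF T fin], of i j] by simp
  obtain B i j where B: "B \<in> P" "i \<in> B" "i \<in> S" "j \<in> B" "j \<notin> S"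
    using S(2) unfolding saturated_def by blast
  have "a * (of_bool (i \<in> T) - of_bool (j \<in> T)) = b"
    using eq[OF B(1,2,4)] B by simp
  then consider "b = a" | "b = - a"
    using ab(2) by (cases "i \<in> T"; cases "j \<in> T") auto
  then show ?thesis
  proof cases
    case 1
    have "eq_mod P T S"
    proof (rule eq_modI[OF T S(1)])
      fix B i j assume "B \<in> P" "i \<in> B" "j \<in> B"
      from eq[OF this] show "i \<in> T \<and> j \<notin> T \<longleftrightarrow> i \<in> S \<and> j \<notin> S"
        using 1 ab by (auto simp: of_bool_def split: if_splits)
    qed
    then show ?thesis by simp
  next
    case 2
    have "eq_mod P T (I - S)"
    proof (rule eq_modI[OF T])
      fix B i j assume B: "B \<in> P" "i \<in> B" "j \<in> B"
      then have "i \<in> I" "j \<in> I" using block_subset[OF part] by auto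
      with eq[OF B] show "i \<in> T \<and> j \<notin> T \<longleftrightarrow> i \<in> I - S \<and> j \<notin> I - S"
        using 2 ab by (auto simp: of_bool_def split: if_splits)
    qed simp
    then show ?thesis by simp
  qed
qed

text \<open>Move from \<open>h1\<close> towards a generic vector with the signs of \<open>h2\<close>, just beyond the first wall.\<close>

lemma generic_sign_induct:
  assumes inv: "\<And>s t. s \<in> signs I P \<Longrightarrow> t \<in> signs I P \<Longrightarrow> sign_adjacent I P s t \<Longrightarrow> F s = F t"
    and "generic I P h1" "generic I P h2" "block_agree P (sign_of I h1) (sign_of I h2)"
  shows "F (sign_of I h1) = F (sign_of I h2)"
  using assms(2-)
\<comment> \<open>The induction is on the number of subsets whose walls separate \<open>h1\<close>
  from \<open>h2\<close>.\<close>
proof (induction "card {S. S \<subseteq> I \<and> sgn (sum h1 S) \<noteq> sgn (sum h2 S)}" arbitrary: h1 rule: less_induct)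
  case less
  note h1 = less.prems(1) and agree = less.prems(3)
  let ?a = "sum h1"
  define N where "N = {S. S \<subseteq> I \<and> sgn (?a S) \<noteq> sgn (sum h2 S)}"
  have finN: "finite N" using fin by (auto simp: N_def)
  show ?case
  proof (cases "N = {}")
    case True
    then have "sign_of I h1 = sign_of I h2" by (auto simp: sign_of_eq_iff N_def)
    then show ?thesis by simp
  next
    case False
    \<comment> \<open>If \<open>L (S, T) g \<noteq> 0\<close>, the walls of \<open>S\<close> and \<open>T\<close> are crossed at different times.\<close>
    define K where "K = {(S, T). S \<subseteq> I \<and> T \<subseteq> I \<and> \<not> saturated P S \<and> \<not> saturated P T \<and>
      \<not> eq_mod P T S \<and> \<not> eq_mod P T (I - S)}"
    define L where "L = (\<lambda>(S, T) v. ?a S * sum v T - ?a T * sum v S)"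
    have "K \<subseteq> Pow I \<times> Pow I" by (auto simp: K_def)
    then have finK: "finite K" by (rule finite_subset) (use fin in auto)
    \<comment> \<open>If the form vanished on \<open>Tvee I P\<close>, the sums over
      \<open>S\<close> and \<open>T\<close> would be proportional with nonzero factors, and the two
      sets would agree mod \<open>P\<close> up to complement.\<close>
    have L_nonzero: "\<exists>v\<in>Tvee I P. L k v \<noteq> 0" if k: "k \<in> K" for k
    proof -
      obtain S T where ST: "k = (S, T)" "S \<subseteq> I" "T \<subseteq> I" "\<not> saturated P S" "\<not> saturated P T"
        "\<not> (eq_mod P T S \<or> eq_mod P T (I - S))"
        using k by (auto simp: K_def)
      then have "?a S \<noteq> 0" "?a T \<noteq> 0" using generic_zero_iff[OF part fin h1] by auto
      then show ?thesis
        using proportional_forms_eq_mod[OF ST(2,4,3), of "?a S" "?a T"] ST(1,6) by (auto simp: L_def)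
    qed
    have "L k (\<lambda>i. g i + e * v i) = L k g + e * L k v" for k g v e
      by (cases k) (simp add: L_def sum_perturbation algebra_simps)
    from generic_avoiding_hyperplanes[where L = L and K = K, OF less.prems(2) finK L_nonzero this]
    obtain g where g: "generic I P g" "sign_of I g = sign_of I h2" "\<forall>k\<in>K. L k g \<noteq> 0"
      by blast
    let ?b = "sum g"
    have sgn_g: "sgn (?b S) = sgn (sum h2 S)" if "S \<subseteq> I" for S
      using g(2) that by (auto simp: sign_of_eq_iff)
    \<comment> \<open>Both vectors are generic for \<open>P\<close>, so their sums vanish on the
      same sets; signs that differ are then opposite.\<close>
    have ab: "?a S * ?b S < 0" if "S \<in> N" for S
    proof -
      have S: "S \<subseteq> I" "sgn (?a S) \<noteq> sgn (?b S)" using that sgn_g by (auto simp: N_def)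
      have "?a S = 0 \<longleftrightarrow> ?b S = 0"
        using generic_zero_iff[OF part fin h1 S(1)] generic_zero_iff[OF part fin g(1) S(1)] by simp
      with S(2) show ?thesis by (auto simp: mult_less_0_iff sgn_real_def split: if_splits)
    qed
    \<comment> \<open>\<open>\<tau> S\<close> is the time at which the segment from \<open>h1\<close> to \<open>g\<close> crosses the wall of \<open>S\<close>.\<close>
    define \<tau> where "\<tau> S = ?a S / (?a S - ?b S)" for S
    obtain E where E: "E \<in> N" "\<And>S. S \<in> N \<Longrightarrow> \<tau> E \<le> \<tau> S"
      using ex_min_if_finite[of "\<tau> ` N"] finN False by (force simp: not_less)
    \<comment> \<open>The set of later crossing times may be empty. Inserting 1 makes the minimum
      meaningful and also keeps \<open>t\<close> below 1.\<close>
    let ?M = "insert 1 (\<tau> ` {S \<in> N. \<tau> E < \<tau> S})"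
    have "\<tau> E < Min ?M"
      using finN sgn_segment(4)[OF ab[OF E(1)]] by (auto simp: \<tau>_def)
    then obtain t where t: "\<tau> E < t" "t < Min ?M" using dense by blast
    have t1: "t < 1" and tS: "\<And>S. S \<in> N \<Longrightarrow> \<tau> E < \<tau> S \<Longrightarrow> t < \<tau> S"
      using t(2) finN by auto
    have t0: "0 < t" using t(1) sgn_segment(3)[OF ab[OF E(1)]] by (simp add: \<tau>_def)
    \<comment> \<open>At time \<open>t\<close> the sets of \<open>N\<close> crossed together with
      \<open>E\<close> have switched sign, and the other members of \<open>N\<close> have
      not.\<close>
    define h where "h = (\<lambda>i. h1 i + t * (g i - h1 i))"
    have sum_h: "sum h S = ?a S + t * (?b S - ?a S)" for S
      by (simp add: h_def sum_perturbation sum_subtractf)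
    have crossed: "sgn (sum h S) = sgn (?b S)" if "S \<in> N" "\<tau> S = \<tau> E" for S
      using sgn_segment(1)[OF ab[OF that(1)]] t(1) that(2) by (simp add: sum_h \<tau>_def)
    have uncrossed: "sgn (sum h S) = sgn (?a S)" if "S \<in> N" "\<tau> S \<noteq> \<tau> E" for S
      using sgn_segment(2)[OF ab[OF that(1)]] tS[OF that(1)] E(2)[OF that(1)] that(2)
      by (simp add: sum_h \<tau>_def)
    have stable: "sgn (sum h S) = sgn (?a S)" "sgn (sum h S) = sgn (sum h2 S)" if "S \<subseteq> I" "S \<notin> N" for S
      using that sgn_g[of S] sgn_convex_combination[OF _ t0 t1, of "?a S" "?b S"]
      by (auto simp: sum_h N_def)
    have h: "generic I P h"
      unfolding generic_def
    proof (intro conjI allI impI)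
      have "h1 \<in> Tvee I P" "g \<in> Tvee I P" using h1 g by (auto simp: generic_def)
      then show "h \<in> Tvee I P" by (auto simp: Tvee_def h_def sum_perturbation sum_subtractf)
      fix S assume S: "S \<subseteq> I" "sum h S = 0"
      have "?a S = 0 \<or> ?b S = 0"
        using crossed[of S] uncrossed[of S] stable[of S] S by (metis sgn_0_0)
      then show "saturated P S"
        using generic_zero_iff[OF part fin h1 S(1)] generic_zero_iff[OF part fin g(1) S(1)] by blast
    qed
    have nsat: "\<not> saturated P S" if "S \<in> N" for S
    proof -
      have "S \<subseteq> I" using that by (auto simp: N_def)
      with ab[OF that] generic_zero_iff[OF part fin h1, of S] show ?thesis by auto
    qed
    have inside: "S \<notin> N" if "B \<in> P" "S \<subseteq> B" for S B
      using agree that block_subset[OF part that(1)]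
      by (auto simp: block_agree_def N_def sign_of_subset)
    have mem: "sign_of I h1 \<in> signs I P" "sign_of I h2 \<in> signs I P" "sign_of I h \<in> signs I P"
      using h1 h less.prems(2) by (auto simp: signs_def)
    have EI: "E \<subseteq> I" using E by (auto simp: N_def)
    have "sign_adjacent I P (sign_of I h1) (sign_of I h)"
      unfolding sign_adjacent_def
    proof (intro exI[of _ E] conjI allI impI)
      have "saturated P I" using block_subset[OF part] by (auto simp: saturated_def)
      then show "E \<subset> I" using EI nsat[OF E(1)] by auto
      show "\<not> eq_mod P E {}" using eq_mod_empty_iff[OF part EI] nsat[OF E(1)] by simp
      \<comment> \<open>The reduction of a semisimple set lies in one block, where \<open>h1\<close>
        and \<open>h2\<close> agree, and it has the same sign as the set itself; but
        \<open>E\<close> is in \<open>N\<close>.\<close>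
      show "\<not> semisimple_subset P E"
      proof
        assume "semisimple_subset P E"
        then obtain B where B: "B \<in> P" "Redn P E \<subseteq> B" by (auto simp: semisimple_subset_def)
        then have "sign_of I h1 (Redn P E) = sign_of I h2 (Redn P E)"
          using agree by (simp add: block_agree_def)
        then have "sign_of I h1 E = sign_of I h2 E"
          using signs_Redn[OF part fin mem(1) EI] signs_Redn[OF part fin mem(2) EI] by simp
        with E(1) show False by (simp add: N_def sign_of_subset)
      qed
      fix S assume S: "S \<subseteq> I" "sign_of I h1 S \<noteq> sign_of I h S"
      then have SN: "S \<in> N" "\<tau> S = \<tau> E"
        using stable[of S] uncrossed[of S] by (auto simp: sign_of_subset)
      \<comment> \<open>Clearing denominators turns equal crossing times into a zero of the form for
        the pair \<open>(E, S)\<close>, which \<open>g\<close> avoids for pairs in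
        \<open>K\<close>.\<close>
      have "?a S - ?b S \<noteq> 0" "?a E - ?b E \<noteq> 0"
        using ab[OF SN(1)] ab[OF E(1)] by (auto simp: mult_less_0_iff)
      then have "?a S * (?a E - ?b E) = ?a E * (?a S - ?b S)"
        using SN(2) by (simp add: \<tau>_def frac_eq_eq)
      then have "L (E, S) g = 0" by (simp add: L_def algebra_simps)
      then have "(E, S) \<notin> K" using g(3) by blast
      then show "eq_mod P S E \<or> eq_mod P S (I - E)"
        using EI S(1) nsat[OF E(1)] nsat[OF SN(1)] by (auto simp: K_def)
    qed
    then have "F (sign_of I h1) = F (sign_of I h)" using inv mem by blast
    also have "\<dots> = F (sign_of I h2)"
    proof (rule less.hyps[OF _ h less.prems(2)])
      \<comment> \<open>The wall of \<open>E\<close> has been crossed and no set outside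
        \<open>N\<close> has become separating, so the count drops.\<close>
      have "S \<in> N - {E}" if "S \<subseteq> I" "sgn (sum h S) \<noteq> sgn (sum h2 S)" for S
        using stable(2)[OF that(1)] that(2) crossed[OF E(1)] sgn_g[OF EI] by auto
      then have "{S. S \<subseteq> I \<and> sgn (sum h S) \<noteq> sgn (sum h2 S)} \<subseteq> N - {E}" by blast
      then have "card {S. S \<subseteq> I \<and> sgn (sum h S) \<noteq> sgn (sum h2 S)} \<le> card (N - {E})"
        using finN by (intro card_mono) auto
      also have "\<dots> < card N" by (rule card_Diff1_less[OF finN E(1)])
      finally show "card {S. S \<subseteq> I \<and> sgn (sum h S) \<noteq> sgn (sum h2 S)} <
          card {S. S \<subseteq> I \<and> sgn (sum h1 S) \<noteq> sgn (sum h2 S)}" by (simp add: N_def)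
      show "block_agree P (sign_of I h) (sign_of I h2)"
        using inside stable(2) block_subset[OF part]
        unfolding block_agree_def by (metis sign_of_subset subset_trans)
    qed
    finally show ?thesis .
  qed
qed

lemma block_local_if_adjacent_invariant:
  assumes "\<And>s t. s \<in> signs I P \<Longrightarrow> t \<in> signs I P \<Longrightarrow> sign_adjacent I P s t \<Longrightarrow> F s = F t"
  shows "block_local I P F"
  unfolding block_local_def using generic_sign_induct[of F] assms by (auto simp: signs_def)

end

section \<open>Derivatives of functions of signs\<close>

definition sign_deriv :: "'a set \<times> 'a set \<Rightarrow> (('a set \<Rightarrow> real) \<Rightarrow> 'k::ab_group_add) \<Rightarrow> ('a set \<Rightarrow> real) \<Rightarrow> 'k" where
  "sign_deriv V F s = F (cut_sign V s) - F (cut_sign (prod.swap V) s)"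

lemma sign_deriv_swap: "sign_deriv (prod.swap V) F s = - sign_deriv V F s"
  by (simp add: sign_deriv_def)

lemma is_cut_swap: "is_cut P (prod.swap V) \<longleftrightarrow> is_cut P V"
  by (cases V) (auto simp: Un_commute Int_commute)

lemma cut_partition_swap: "cut_partition P (prod.swap V) = cut_partition P V"
  by (cases V) (auto simp: Un_commute)

text \<open>At a tie of \<open>s\<close>, both sides are 0 if \<open>S\<close> contains all or none
  of \<open>A\<close>, \<open>B\<close>, \<open>C\<close>. Otherwise both sides of the first
  equation are +1 exactly when \<open>S\<close> contains \<open>A\<close>, and both sides of the
  second are -1 exactly then. Thus only the extreme part matters.\<close>

lemma cut_sign_cut_sign:
  "cut_sign (A \<union> B, C) (cut_sign (A, B) s) = cut_sign (C \<union> A, B) (cut_sign (A, C) s)"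
  "cut_sign (C, A \<union> B) (cut_sign (B, A) s) = cut_sign (B, C \<union> A) (cut_sign (C, A) s)"
  by (auto simp: cut_sign_def fun_eq_iff)

text \<open>The three second derivatives expand into twelve terms, which cancel in six pairs by the
  two equations above and their cyclic rotations.\<close>

lemma sign_deriv_jacobi:
  "sign_deriv (A, B) (sign_deriv (A \<union> B, C) F) s + sign_deriv (B, C) (sign_deriv (B \<union> C, A) F) s
    + sign_deriv (C, A) (sign_deriv (C \<union> A, B) F) s = 0"
  using cut_sign_cut_sign[of A B C s] cut_sign_cut_sign[of B C A s] cut_sign_cut_sign[of C A B s]
  by (simp add: sign_deriv_def)

context
  fixes I :: "'a set" and P :: "'a set set"
  assumes part: "partition_on I P" and fin: "finite I"
begin

lemma cut_deriv_face_of: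
  assumes V: "is_cut P V" and s: "s \<in> signs I (cut_partition P V)"
  shows "cut_deriv I P V f (face_of I s) = sign_deriv V (\<lambda>s. f (face_of I s)) s"
  using assms cut_face_face_of[OF part fin V s] cut_face_face_of[OF part fin, of "prod.swap V" s]
    adjoint_faces_eq[OF partition_on_cut_partition[OF part V] fin]
  by (simp add: cut_deriv_def sign_deriv_def is_cut_swap cut_partition_swap)

text \<open>The criterion is symmetric in \<open>S\<close> and its complement, so both have
  reductions that meet the same blocks.\<close>

lemma Redn_meets_iff:
  assumes "S \<subseteq> I" "B \<in> P"
  shows "B \<inter> Redn P S \<noteq> {} \<longleftrightarrow> B \<inter> S \<noteq> {} \<and> B \<inter> (I - S) \<noteq> {}"
proof -
  have "B \<subseteq> I" using block_subset[OF part assms(2)] .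
  have "x \<in> Redn P S \<longleftrightarrow> x \<in> S \<and> \<not> B \<subseteq> S" if "x \<in> B" for x
    using Redn_iff[OF part assms(1), of x] same_block[OF part assms(2) _ that] that assms(2) by metis
  with \<open>B \<subseteq> I\<close> show ?thesis by blast
qed

text \<open>The reduction of the set \<open>E\<close> behind the adjacency is nonempty and not
  inside one block, so it meets two blocks. Every set equal to \<open>E\<close> or its complement
  mod \<open>P\<close> meets the same two.\<close>

lemma sign_adjacent_split:
  assumes "sign_adjacent I P s t"
  obtains B1 B2 where "B1 \<in> P" "B2 \<in> P" "B1 \<noteq> B2"
    "\<And>S. S \<subseteq> I \<Longrightarrow> s S \<noteq> t S \<Longrightarrow> S \<inter> B1 \<noteq> {} \<and> S \<inter> B2 \<noteq> {}"
proof -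
  obtain E where E: "E \<subset> I" "\<not> eq_mod P E {}" "\<not> semisimple_subset P E"
    "\<And>S. S \<subseteq> I \<Longrightarrow> s S \<noteq> t S \<Longrightarrow> eq_mod P S E \<or> eq_mod P S (I - E)"
    using assms by (auto simp: sign_adjacent_def)
  have EI: "E \<subseteq> I" using E(1) by auto
  have "Redn P {} = {}" by (simp add: Redn_def)
  then obtain x where x: "x \<in> Redn P E" using E(2) by (auto simp: eq_mod_def)
  then have "x \<in> I" using Redn_subset[of P E] EI by auto
  then obtain B1 where B1: "B1 \<in> P" "x \<in> B1" using in_some_block[OF part] by blast
  then obtain y where y: "y \<in> Redn P E" "y \<notin> B1"
    using E(2,3) by (auto simp: semisimple_subset_def)
  then have "y \<in> I" using Redn_subset[of P E] EI by auto
  then obtain B2 where B2: "B2 \<in> P" "y \<in> B2" using in_some_block[OF part] by blast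
  have "B \<inter> S \<noteq> {}" if B: "B \<in> P" "B \<inter> Redn P E \<noteq> {}" and S: "S \<subseteq> I" "s S \<noteq> t S" for B S
  proof -
    have "B \<inter> Redn P (I - E) \<noteq> {}"
      using Redn_meets_iff[OF EI B(1)] Redn_meets_iff[OF _ B(1), of "I - E"] B(2) EI
      by (simp add: double_diff)
    then have "B \<inter> Redn P S \<noteq> {}" using E(4)[OF S] B(2) by (auto simp: eq_mod_def)
    then show ?thesis using Redn_subset[of P S] by blast
  qed
  then show thesis using that[OF B1(1) B2(1)] B1 B2 x y by (metis Int_commute disjoint_iff)
qed

text \<open>Signs that differ only on sets meeting two blocks of \<open>cut_partition P V\<close> agree inside each
  block after a second cut, unless both blocks lie in the same block of \<open>cut_partition P V\<close>.\<close>

lemma sign_deriv_sign_deriv_eq_if_separated: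
  assumes V: "is_cut P V" and W: "is_cut (cut_partition P V) W"
    and loc: "block_local I (cut_partition P V) (sign_deriv V F)"
    and s: "s \<in> signs I (cut_partition (cut_partition P V) W)"
    and t: "t \<in> signs I (cut_partition (cut_partition P V) W)"
    and sep: "\<And>B. B \<in> cut_partition P V \<Longrightarrow> B \<inter> B1 = {} \<or> B \<inter> B2 = {}"
    and diff: "\<And>S. S \<subseteq> I \<Longrightarrow> s S \<noteq> t S \<Longrightarrow> S \<inter> B1 \<noteq> {} \<and> S \<inter> B2 \<noteq> {}"
  shows "sign_deriv W (sign_deriv V F) s = sign_deriv W (sign_deriv V F) t"
proof -
  let ?Q = "cut_partition P V"
  note partQ = partition_on_cut_partition[OF part V]
  have "s S = t S" if "B \<in> ?Q" "S \<subseteq> B" for B S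
    using sep[OF that(1)] diff[of S] that(2) block_subset[OF partQ that(1)] by blast
  then have "block_agree ?Q (cut_sign W' s) (cut_sign W' t)" for W' :: "'a set \<times> 'a set"
    by (simp add: block_agree_def cut_sign_def)
  moreover have "cut_sign W' u \<in> signs I ?Q"
    if "W' \<in> {W, prod.swap W}" "u \<in> signs I (cut_partition ?Q W)" for W' u
    using that cut_sign_in_signs[OF partQ fin, of W' u] W by (auto simp: is_cut_swap cut_partition_swap)
  ultimately have "sign_deriv V F (cut_sign W' s) = sign_deriv V F (cut_sign W' t)" if "W' \<in> {W, prod.swap W}" for W'
    using loc s t that unfolding block_local_def by blast
  then show ?thesis by (simp add: sign_deriv_def[of W])
qed

text \<open>The order of two cuts matters only at ties containing a part of each cut. Such a set
  meets two blocks of \<open>P\<close>, and a local \<open>F\<close> does not see its sign.\<close>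

lemma sign_deriv_commute:
  assumes loc: "block_local I P F"
    and V: "is_cut P V" and W: "is_cut P W" and ne: "fst V \<union> snd V \<noteq> fst W \<union> snd W"
    and VW: "is_cut (cut_partition P V) W" "is_cut (cut_partition P W) V"
    and comm: "cut_partition (cut_partition P V) W = cut_partition (cut_partition P W) V"
    and s: "s \<in> signs I (cut_partition (cut_partition P V) W)"
  shows "sign_deriv W (sign_deriv V F) s = sign_deriv V (sign_deriv W F) s"
proof -
  have eq: "F (cut_sign V' (cut_sign W' s)) = F (cut_sign W' (cut_sign V' s))"
    if V': "V' \<in> {V, prod.swap V}" and W': "W' \<in> {W, prod.swap W}" for V' W'
  proof -
    have cuts: "is_cut P V'" "is_cut P W'" "is_cut (cut_partition P V') W'" "is_cut (cut_partition P W') V'"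
      "s \<in> signs I (cut_partition (cut_partition P V') W')" "s \<in> signs I (cut_partition (cut_partition P W') V')"
      using V' W' V W VW s comm by (auto simp: is_cut_swap cut_partition_swap)
    have blocks: "fst V' \<union> snd V' \<in> P" "fst W' \<union> snd W' \<in> P" "fst V' \<union> snd V' \<noteq> fst W' \<union> snd W'"
      "fst V' \<noteq> {}" "snd V' \<noteq> {}" "fst W' \<noteq> {}" "snd W' \<noteq> {}"
      using V' W' V W ne by (cases V; cases W; auto simp: Un_commute)+
    have "(\<not> fst V' \<subseteq> S \<and> \<not> snd V' \<subseteq> S) \<or> (\<not> fst W' \<subseteq> S \<and> \<not> snd W' \<subseteq> S)"
      if "B \<in> P" "S \<subseteq> B" for B S
      using that blocks same_block[OF part blocks(1) that(1)] same_block[OF part blocks(2) that(1)]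
      by blast
    then have "block_agree P (cut_sign V' (cut_sign W' s)) (cut_sign W' (cut_sign V' s))"
      by (fastforce simp: block_agree_def cut_sign_def)
    moreover have "cut_sign V' (cut_sign W' s) \<in> signs I P"
      using cut_sign_in_signs[OF partition_on_cut_partition[OF part cuts(1)] fin cuts(3,5)]
      by (rule cut_sign_in_signs[OF part fin cuts(1)])
    moreover have "cut_sign W' (cut_sign V' s) \<in> signs I P"
      using cut_sign_in_signs[OF partition_on_cut_partition[OF part cuts(2)] fin cuts(4,6)]
      by (rule cut_sign_in_signs[OF part fin cuts(2)])
    ultimately show ?thesis using loc by (auto simp: block_local_def)
  qed
  show ?thesis
    using eq[of V W] eq[of V "prod.swap W"] eq[of "prod.swap V" W] eq[of "prod.swap V" "prod.swap W"]
    by (simp add: sign_deriv_def)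
qed

lemma nested_cut:
  assumes "X \<noteq> {}" "Y \<noteq> {}" "Z \<noteq> {}" "X \<inter> Y = {}" "X \<inter> Z = {}" "Y \<inter> Z = {}" "X \<union> Y \<union> Z \<in> P"
  shows "is_cut P (X \<union> Y, Z)" "is_cut (cut_partition P (X \<union> Y, Z)) (X, Y)"
    "cut_partition (cut_partition P (X \<union> Y, Z)) (X, Y) = P - {X \<union> Y \<union> Z} \<union> {X, Y, Z}"
proof -
  show "is_cut P (X \<union> Y, Z)" using assms by auto
  show "is_cut (cut_partition P (X \<union> Y, Z)) (X, Y)" using assms by auto
  \<comment> \<open>The second cut removes \<open>X \<union> Y\<close>; the point \<open>x\<close>
    shows that no original block is lost with it.\<close>
  obtain x where "x \<in> X" using assms by auto
  then have "X \<union> Y \<notin> P"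
    using same_block[OF part assms(7), of "X \<union> Y" x] assms(3,5,6) by blast
  moreover have "X \<union> Y \<noteq> Z" using assms by auto
  ultimately show "cut_partition (cut_partition P (X \<union> Y, Z)) (X, Y) = P - {X \<union> Y \<union> Z} \<union> {X, Y, Z}"
    by auto
qed

text \<open>Splitting off \<open>C\<close> first leaves \<open>A\<close> and \<open>B\<close>
  together, so locality of that derivative is not enough. In the other two Jacobi terms the first
  cut puts \<open>A\<close> and \<open>B\<close> into different blocks.\<close>

lemma sign_deriv_sign_deriv_eq_nested:
  assumes ABC: "A \<noteq> {}" "B \<noteq> {}" "C \<noteq> {}" "A \<inter> B = {}" "A \<inter> C = {}" "B \<inter> C = {}" "A \<union> B \<union> C \<in> P"
    and loc: "\<And>V. is_cut P V \<Longrightarrow> block_local I (cut_partition P V) (sign_deriv V F)"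
    and s: "s \<in> signs I (P - {A \<union> B \<union> C} \<union> {A, B, C})"
    and t: "t \<in> signs I (P - {A \<union> B \<union> C} \<union> {A, B, C})"
    and diff: "\<And>S. S \<subseteq> I \<Longrightarrow> s S \<noteq> t S \<Longrightarrow> S \<inter> A \<noteq> {} \<and> S \<inter> B \<noteq> {}"
  shows "sign_deriv (A, B) (sign_deriv (A \<union> B, C) F) s = sign_deriv (A, B) (sign_deriv (A \<union> B, C) F) t"
proof -
  have away: "K \<inter> A = {}" "K \<inter> B = {}" if "K \<in> P" "K \<noteq> A \<union> B \<union> C" for K
    using same_block[OF part that(1) ABC(7)] that(2) by blast+
  have ins: "{B, C, A} = {A, B, C}" "{C, A, B} = {A, B, C}" by auto
  have un: "B \<union> C \<union> A = A \<union> B \<union> C" "C \<union> A \<union> B = A \<union> B \<union> C" by auto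
  have "A \<inter> B = {}" "B \<inter> A = {}" "C \<inter> A = {}" "C \<inter> B = {}" using ABC by auto
  note ABC' = this
  note BCA = nested_cut[of B C A, OF ABC(2,3,1,6) ABC'(2,3), unfolded un ins, OF ABC(7)]
  note CAB = nested_cut[of C A B, OF ABC(3,1,2) ABC'(3,4) ABC(4), unfolded un ins, OF ABC(7)]
  have 1: "sign_deriv (B, C) (sign_deriv (B \<union> C, A) F) s = sign_deriv (B, C) (sign_deriv (B \<union> C, A) F) t"
  proof (rule sign_deriv_sign_deriv_eq_if_separated[OF BCA(1,2) loc[OF BCA(1)] s[folded BCA(3)] t[folded BCA(3)] _ diff])
    fix K assume "K \<in> cut_partition P (B \<union> C, A)"
    then have "K = B \<union> C \<or> K = A \<or> K \<in> P \<and> K \<noteq> A \<union> B \<union> C" using un by auto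
    then show "K \<inter> A = {} \<or> K \<inter> B = {}"
      using away(1)[of K] ABC(4) ABC' by (elim disjE) (simp_all add: Int_Un_distrib2)
  qed
  have 2: "sign_deriv (C, A) (sign_deriv (C \<union> A, B) F) s = sign_deriv (C, A) (sign_deriv (C \<union> A, B) F) t"
  proof (rule sign_deriv_sign_deriv_eq_if_separated[OF CAB(1,2) loc[OF CAB(1)] s[folded CAB(3)] t[folded CAB(3)] _ diff])
    fix K assume "K \<in> cut_partition P (C \<union> A, B)"
    then have "K = C \<union> A \<or> K = B \<or> K \<in> P \<and> K \<noteq> A \<union> B \<union> C" using un by auto
    then show "K \<inter> A = {} \<or> K \<inter> B = {}"
      using away(1)[of K] ABC(4) ABC' by (elim disjE) (simp_all add: Int_Un_distrib2)
  qed
  have "sign_deriv (A, B) (sign_deriv (A \<union> B, C) F) u =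
      - (sign_deriv (B, C) (sign_deriv (B \<union> C, A) F) u + sign_deriv (C, A) (sign_deriv (C \<union> A, B) F) u)" for u
    using sign_deriv_jacobi[of A B C F u] by (simp only: add.assoc eq_neg_iff_add_eq_0)
  with 1 2 show ?thesis by simp
qed

end

section \<open>Locality of second derivatives\<close>

context
  fixes I :: "'a set" and P :: "'a set set"
  assumes part: "partition_on I P" and fin: "finite I"
begin

lemma block_local_sign_deriv_sign_deriv:
  assumes F: "block_local I P F" and loc: "\<And>V. is_cut P V \<Longrightarrow> block_local I (cut_partition P V) (sign_deriv V F)"
    and V: "is_cut P V" and W: "is_cut (cut_partition P V) W"
  shows "block_local I (cut_partition (cut_partition P V) W) (sign_deriv W (sign_deriv V F))"
proof -
  let ?Q = "cut_partition P V"
  let ?R = "cut_partition ?Q W"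
  note partQ = partition_on_cut_partition[OF part V]
  note partR = partition_on_cut_partition[OF partQ W]
  obtain A B where AB: "W = (A, B)" by (cases W)
  obtain C D where CD: "V = (C, D)" by (cases V)
  have W': "A \<noteq> {}" "B \<noteq> {}" "A \<inter> B = {}" "A \<union> B \<in> ?Q" using W AB by auto
  have V': "C \<noteq> {}" "D \<noteq> {}" "C \<inter> D = {}" "C \<union> D \<in> P" using V CD by auto
  show ?thesis
  proof (rule block_local_if_adjacent_invariant[OF partR fin])
    fix s t assume s: "s \<in> signs I ?R" and t: "t \<in> signs I ?R" and "sign_adjacent I ?R s t"
    then obtain B1 B2 where B: "B1 \<in> ?R" "B2 \<in> ?R" "B1 \<noteq> B2"
      and diff: "\<And>S. S \<subseteq> I \<Longrightarrow> s S \<noteq> t S \<Longrightarrow> S \<inter> B1 \<noteq> {} \<and> S \<inter> B2 \<noteq> {}"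
      using sign_adjacent_split[OF partR fin] by metis
    show "sign_deriv W (sign_deriv V F) s = sign_deriv W (sign_deriv V F) t"
    proof (cases "\<forall>K\<in>?Q. K \<inter> B1 = {} \<or> K \<inter> B2 = {}")
      case True
      then show ?thesis using sign_deriv_sign_deriv_eq_if_separated[OF part fin V W loc[OF V] s t _ diff] by blast
    next
      case False
      then obtain K where K: "K \<in> ?Q" "K \<inter> B1 \<noteq> {}" "K \<inter> B2 \<noteq> {}" by auto
      \<comment> \<open>A block untouched by \<open>W\<close> would still be a block of
        \<open>?R\<close>, and so would equal both \<open>B1\<close> and \<open>B2\<close>.\<close>
      have KAB: "K = A \<union> B"
      proof (rule ccontr)
        assume "K \<noteq> A \<union> B"
        then have "K \<in> ?R" using K(1) AB by auto
        then have "K = B1" "K = B2" using same_block[OF partR] B K by blast+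
        with B(3) show False by simp
      qed
      have "A \<in> ?R" "B \<in> ?R" using AB by auto
      then have "B1 \<in> {A, B}" "B2 \<in> {A, B}"
        using same_block[OF partR B(1)] same_block[OF partR B(2)] K KAB by blast+
      with B(3) have diffAB: "S \<inter> A \<noteq> {} \<and> S \<inter> B \<noteq> {}" if "S \<subseteq> I" "s S \<noteq> t S" for S
        using diff[OF that] by auto
      have "K = C \<or> K = D \<or> K \<in> P \<and> K \<noteq> C \<union> D" using K(1) CD by auto
      \<comment> \<open>\<open>W\<close> cuts the first part of \<open>V\<close>, the second part,
        or a block that \<open>V\<close> leaves alone.\<close>
      then consider "A \<union> B = C" | "A \<union> B = D" | "A \<union> B \<in> P" "A \<union> B \<noteq> C \<union> D" "A \<union> B \<noteq> C" "A \<union> B \<noteq> D"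
        unfolding KAB by blast
      then show ?thesis
      proof cases
        case 1
        then have *: "A \<noteq> {}" "B \<noteq> {}" "D \<noteq> {}" "A \<inter> B = {}" "A \<inter> D = {}" "B \<inter> D = {}" "A \<union> B \<union> D \<in> P"
          using V' W' by auto
        have R: "?R = P - {A \<union> B \<union> D} \<union> {A, B, D}"
          using nested_cut(3)[OF part fin *] by (simp only: AB CD 1)
        have "sign_deriv (A, B) (sign_deriv (A \<union> B, D) F) s = sign_deriv (A, B) (sign_deriv (A \<union> B, D) F) t"
          by (rule sign_deriv_sign_deriv_eq_nested[OF part fin * loc s[unfolded R] t[unfolded R] diffAB])
        then show ?thesis by (simp only: AB CD 1)
      next
        case 2
        then have *: "A \<noteq> {}" "B \<noteq> {}" "C \<noteq> {}" "A \<inter> B = {}" "A \<inter> C = {}" "B \<inter> C = {}" "A \<union> B \<union> C \<in> P"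
          using V' W' by (auto simp: Un_commute)
        \<comment> \<open>Reversing \<open>V\<close> only changes the sign of the derivative and
          reduces this case to the form of the nested lemma.\<close>
        have V_swap: "prod.swap V = (A \<union> B, C)" by (simp add: CD 2)
        have R: "?R = P - {A \<union> B \<union> C} \<union> {A, B, C}"
          using nested_cut(3)[OF part fin *] cut_partition_swap[of P V] by (simp only: AB V_swap)
        have "sign_deriv W (sign_deriv (prod.swap V) F) s = sign_deriv W (sign_deriv (prod.swap V) F) t"
          unfolding AB V_swap
          by (rule sign_deriv_sign_deriv_eq_nested[OF part fin * loc s[unfolded R] t[unfolded R] diffAB])
        then show ?thesis by (simp add: sign_deriv_def[of W] sign_deriv_swap) (metis minus_diff_eq)
      next
        case 3
        have cW: "is_cut P W" using W' 3 AB by simp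
        have ABCD: "(A \<union> B) \<inter> (C \<union> D) = {}"
          using same_block[OF part 3(1) V'(4)] 3(2) by blast
        have cV: "is_cut (cut_partition P W) V" using V' 3 CD AB by auto
        have "cut_partition (cut_partition P V) W = P - {C \<union> D, A \<union> B} \<union> {A, B, C, D}"
          unfolding AB CD using 3 by auto
        moreover have "cut_partition (cut_partition P W) V = P - {C \<union> D, A \<union> B} \<union> {A, B, C, D}"
          unfolding AB CD using 3 V' W' ABCD by auto
        ultimately have eq: "?R = cut_partition (cut_partition P W) V" by simp
        \<comment> \<open>With \<open>W\<close> performed first, \<open>A\<close> and
          \<open>B\<close> are already in different blocks when \<open>V\<close> is applied.\<close>
        have "sign_deriv V (sign_deriv W F) s = sign_deriv V (sign_deriv W F) t"
        proof (rule sign_deriv_sign_deriv_eq_if_separated[OF part fin cW cV loc[OF cW] s[unfolded eq] t[unfolded eq] _ diffAB])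
          fix K assume "K \<in> cut_partition P W"
          then consider "K = A" | "K = B" | "K \<in> P" "K \<noteq> A \<union> B" using AB by auto
          then show "K \<inter> A = {} \<or> K \<inter> B = {}"
          proof cases
            case 3
            then show ?thesis using same_block[OF part \<open>K \<in> P\<close> \<open>A \<union> B \<in> P\<close>] by blast
          qed (use W' in auto)
        qed
        moreover have "sign_deriv W (sign_deriv V F) u = sign_deriv V (sign_deriv W F) u" if "u \<in> signs I ?R" for u
          using sign_deriv_commute[OF part fin F V cW _ W cV eq that] AB CD 3(2) by auto
        ultimately show ?thesis using s t by simp
      qed
    qed
  qed
qed

end

section \<open>Semisimplicity of forest derivatives\<close>

lemma block_local_cong:
  "(\<And>s. s \<in> signs I P \<Longrightarrow> F s = G s) \<Longrightarrow> block_local I P F \<longleftrightarrow> block_local I P G"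
  by (auto simp: block_local_def)

lemma cut_deriv_functional: "cut_deriv I P V f \<in> functionals I (cut_partition P V)"
  by (simp add: cut_deriv_def functionals_def)

lemma semisimple_iff:
  assumes "partition_on I P" "finite I" "f \<in> functionals I P"
  shows "semisimple I P f \<longleftrightarrow> block_local I P (\<lambda>s. f (face_of I s))"
  using block_local_if_semisimple semisimple_if_block_local assms by blast

lemma semisimple_cut_deriv_iff:
  assumes "partition_on I P" "finite I" "is_cut P V"
  shows "semisimple I (cut_partition P V) (cut_deriv I P V f) \<longleftrightarrow>
    block_local I (cut_partition P V) (sign_deriv V (\<lambda>s. f (face_of I s)))"
  unfolding semisimple_iff[OF partition_on_cut_partition[OF assms(1,3)] assms(2) cut_deriv_functional]
  by (intro block_local_cong cut_deriv_face_of assms)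

text \<open>This is the inheritance step: it gives a first derivative of \<open>f\<close> the same
  hypotheses over the finer partition that \<open>f\<close> has over \<open>P\<close>.\<close>

lemma semisimple_second_deriv:
  fixes f :: "('a \<Rightarrow> real) set \<Rightarrow> 'k::field"
  assumes part: "partition_on I P" and fin: "finite I" and f: "f \<in> functionals I P" "semisimple I P f"
    and deriv: "\<And>V. is_cut P V \<Longrightarrow> semisimple I (cut_partition P V) (cut_deriv I P V f)"
    and V: "is_cut P V" and W: "is_cut (cut_partition P V) W"
  shows "semisimple I (cut_partition (cut_partition P V) W)
    (cut_deriv I (cut_partition P V) W (cut_deriv I P V f))"
proof -
  let ?F = "\<lambda>s. f (face_of I s)" and ?Q = "cut_partition P V"
  note partQ = partition_on_cut_partition[OF part V]
  have "sign_deriv W (\<lambda>s. cut_deriv I P V f (face_of I s)) s = sign_deriv W (sign_deriv V ?F) s"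
    if s: "s \<in> signs I (cut_partition ?Q W)" for s
  proof -
    have "cut_sign W s \<in> signs I ?Q" "cut_sign (prod.swap W) s \<in> signs I ?Q"
      using cut_sign_in_signs[OF partQ fin] W s by (auto simp: is_cut_swap cut_partition_swap)
    then show ?thesis by (simp add: sign_deriv_def[of W] cut_deriv_face_of[OF part fin V])
  qed
  moreover have "block_local I (cut_partition ?Q W) (sign_deriv W (sign_deriv V ?F))"
    using block_local_sign_deriv_sign_deriv[OF part fin _ _ V W, of ?F] f deriv
      semisimple_iff[OF part fin f(1)] semisimple_cut_deriv_iff[OF part fin, of _ f] by blast
  ultimately show ?thesis
    using semisimple_cut_deriv_iff[OF partQ fin W] block_local_cong by metis
qed

text \<open>The induction peels off the first cut and replaces both the partition and the
  functional. Its invariant is semisimplicity of the functional and of all its first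
  derivatives.\<close>

lemma semisimple_forest_deriv:
  fixes f :: "('a \<Rightarrow> real) set \<Rightarrow> 'k::field"
  assumes "partition_on I P" "finite I" "f \<in> functionals I P" "semisimple I P f"
    and "\<And>V. is_cut P V \<Longrightarrow> semisimple I (cut_partition P V) (cut_deriv I P V f)"
    and "layered_forest P Vs"
  shows "semisimple I (forest_partition P Vs) (forest_deriv I P Vs f)"
  using assms
proof (induction Vs arbitrary: P f)
  case (Cons V Vs)
  then have V: "is_cut P V" "layered_forest (cut_partition P V) Vs" by auto
  show ?case
    using Cons.IH[OF partition_on_cut_partition[OF Cons.prems(1) V(1)] Cons.prems(2)
        cut_deriv_functional Cons.prems(5)[OF V(1)] semisimple_second_deriv V(2)]
      Cons.prems V(1) by simp
qed simp

lemma partition_on_whole: "I \<noteq> {} \<Longrightarrow> partition_on I {I}"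
  by (auto simp: partition_on_def disjoint_def)

lemma semisimply_differentiable_iff:
  fixes f :: "('a \<Rightarrow> real) set \<Rightarrow> 'k::field"
  assumes fin: "finite I" and ne: "I \<noteq> {}" and f: "f \<in> functionals I {I}"
  shows "semisimply_differentiable I {I} f \<longleftrightarrow>
    (\<forall>S T. is_cut {I} (S, T) \<longrightarrow> semisimple I {S, T} (cut_deriv I {I} (S, T) f))"
    (is "_ \<longleftrightarrow> ?R")
proof
  have Q: "cut_partition {I} (S, T) = {S, T}" if "is_cut {I} (S, T)" for S T
    using that by auto
  {
    assume *: "semisimply_differentiable I {I} f"
    show ?R
    proof (intro allI impI)
      fix S T assume "is_cut {I} (S, T)"
      with *[unfolded semisimply_differentiable_def, rule_format, of "[(S, T)]"] Q
      show "semisimple I {S, T} (cut_deriv I {I} (S, T) f)" by simp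
    qed
  next
    note part = partition_on_whole[OF ne]
    assume ?R
    then have deriv: "semisimple I (cut_partition {I} V) (cut_deriv I {I} V f)" if "is_cut {I} V" for V
      using that Q by (cases V) metis
    \<comment> \<open>Over the one-block partition, agreement inside the block is equality, so every
      functional is semisimple.\<close>
    have "s = t" if "s \<in> signs I {I}" "t \<in> signs I {I}" "block_agree {I} s t" for s t
      using signs_eqI[OF part fin that(1,2)] that(3) by (simp add: block_agree_def)
    then have "block_local I {I} (\<lambda>s. f (face_of I s))" unfolding block_local_def by blast
    then have "semisimple I {I} f" using semisimple_iff[OF part fin f] by blast
    then show "semisimply_differentiable I {I} f"
      unfolding semisimply_differentiable_def
      using semisimple_forest_deriv[OF part fin f] deriv by blast
  }
qed

section \<open>Semisimplicity as invariance under Steinmann adjacency\<close>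

context
  fixes I :: "'a set" and P :: "'a set set"
  assumes part: "partition_on I P" and fin: "finite I"
begin

lemma steinmann_adjacent_face_of_iff:
  assumes s: "s \<in> signs I P" and t: "t \<in> signs I P"
  shows "steinmann_adjacent I P (face_of I s) (face_of I t) \<longleftrightarrow> s \<noteq> t \<and> sign_adjacent I P s t"
proof -
  have "(\<forall>S. S \<noteq> {} \<and> S \<subset> I \<and> face_sign (face_of I s) S \<noteq> face_sign (face_of I t) S \<longrightarrow>
        eq_mod P S E \<or> eq_mod P S (I - E)) \<longleftrightarrow>
      (\<forall>S\<subseteq>I. s S \<noteq> t S \<longrightarrow> eq_mod P S E \<or> eq_mod P S (I - E))" for E
    using face_sign_face_of[OF part fin s] face_sign_face_of[OF part fin t]
      signs_trivial[OF part fin s] signs_trivial[OF part fin t]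
    by (metis psubset_eq)
  moreover have "face_of I s \<in> adjoint_faces I P" "face_of I t \<in> adjoint_faces I P"
    using s t by (auto simp: adjoint_faces_eq[OF part fin])
  ultimately show ?thesis
    using face_of_inject[OF part fin s] by (auto simp: steinmann_adjacent_def sign_adjacent_def)
qed

text \<open>Adjacent signs differ only on sets that meet two fixed blocks, and a subset of a single
  block cannot do so.\<close>

lemma block_agree_if_sign_adjacent:
  assumes "sign_adjacent I P s t"
  shows "block_agree P s t"
proof -
  obtain B1 B2 where B: "B1 \<in> P" "B2 \<in> P" "B1 \<noteq> B2"
    "\<And>S. S \<subseteq> I \<Longrightarrow> s S \<noteq> t S \<Longrightarrow> S \<inter> B1 \<noteq> {} \<and> S \<inter> B2 \<noteq> {}"
    using sign_adjacent_split[OF part fin assms] by metis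
  have "s S = t S" if "K \<in> P" "S \<subseteq> K" for K S
  proof (rule ccontr)
    assume "s S \<noteq> t S"
    then have "K \<inter> B1 \<noteq> {}" "K \<inter> B2 \<noteq> {}"
      using B(4)[of S] block_subset[OF part that(1)] that(2) by blast+
    then have "K = B1" "K = B2" using same_block[OF part that(1)] B by blast+
    with B(3) show False by simp
  qed
  then show ?thesis by (simp add: block_agree_def)
qed

text \<open>Adjacent faces agree in the blocks, which gives one direction; the other is the
  wall-crossing induction. This turns semisimplicity into linear equations, which the Steinmann
  generators express.\<close>

lemma semisimple_iff_adjacent_invariant:
  assumes f: "f \<in> functionals I P"
  shows "semisimple I P f \<longleftrightarrow> (\<forall>X1 X2. steinmann_adjacent I P X1 X2 \<longrightarrow> f X1 = f X2)"
proof
  assume "semisimple I P f"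
  then have loc: "block_local I P (\<lambda>s. f (face_of I s))" using semisimple_iff[OF part fin f] by blast
  show "\<forall>X1 X2. steinmann_adjacent I P X1 X2 \<longrightarrow> f X1 = f X2"
  proof (intro allI impI)
    fix X1 X2 assume *: "steinmann_adjacent I P X1 X2"
    then obtain s t where st: "s \<in> signs I P" "t \<in> signs I P" "X1 = face_of I s" "X2 = face_of I t"
      by (auto simp: steinmann_adjacent_def adjoint_faces_eq[OF part fin])
    with * loc show "f X1 = f X2"
      using steinmann_adjacent_face_of_iff block_agree_if_sign_adjacent
      by (auto simp: block_local_def)
  qed
next
  assume *: "\<forall>X1 X2. steinmann_adjacent I P X1 X2 \<longrightarrow> f X1 = f X2"
  have "block_local I P (\<lambda>s. f (face_of I s))"
    using * steinmann_adjacent_face_of_iff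
    by (intro block_local_if_adjacent_invariant[OF part fin]) metis
  then show "semisimple I P f" using semisimple_iff[OF part fin f] by blast
qed

lemma cut_face_in_adjoint_faces:
  assumes "is_cut P V" "X \<in> adjoint_faces I (cut_partition P V)"
  shows "cut_face I P V X \<in> adjoint_faces I P"
  using assms(2) cut_face_face_of[OF part fin assms(1)] cut_sign_in_signs[OF part fin assms(1)]
  by (auto simp: adjoint_faces_eq[OF part fin] adjoint_faces_eq[OF partition_on_cut_partition[OF part assms(1)] fin])

end

section \<open>The pairing and the annihilator of the Steinmann relations\<close>

lemma pairing_superset:
  assumes "finite K" "Poly_Mapping.keys v \<subseteq> K"
  shows "pairing f v = (\<Sum>X\<in>K. Poly_Mapping.lookup v X * f X)"
  unfolding pairing_def by (rule sum.mono_neutral_left) (use assms in \<open>auto simp: in_keys_iff\<close>)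

lemma pairing_add: "pairing f (v + w) = pairing f v + pairing f w"
proof -
  let ?K = "Poly_Mapping.keys v \<union> Poly_Mapping.keys w"
  have "Poly_Mapping.keys (v + w) \<subseteq> ?K" by (rule Poly_Mapping.keys_add)
  then show ?thesis
    by (subst (1 2 3) pairing_superset[of ?K])
      (auto simp: Poly_Mapping.lookup_add sum.distrib algebra_simps)
qed

lemma pairing_scale: "pairing f (free_scale c v) = c * pairing f v"
proof -
  have "Poly_Mapping.keys (free_scale c v) \<subseteq> Poly_Mapping.keys v" by (auto simp: in_keys_iff)
  then show ?thesis
    by (subst (1 2) pairing_superset[of "Poly_Mapping.keys v"])
      (auto simp: sum_distrib_left algebra_simps)
qed

lemma pairing_diff: "pairing f (v - w) = pairing f v - pairing f w"
  using pairing_add[of f "v - w" w] by simp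

lemma pairing_single: "pairing f (Poly_Mapping.single X 1) = f X"
  by (simp add: pairing_def)

lemma subspace_pairing_zero: "free_space.subspace {v. pairing f v = 0}"
  by (auto simp: free_space.subspace_def pairing_add pairing_scale) (simp add: pairing_def)

text \<open>Adjoin \<open>v\<close> to a basis of the span and extend the map that is 1 on
  \<open>v\<close> and 0 on the basis to a linear form. Its values on the basis vectors of the free
  space represent it through \<open>pairing\<close>.\<close>

lemma separating_functional:
  fixes v :: "('a \<Rightarrow> real) set \<Rightarrow>\<^sub>0 'k::field"
  assumes "v \<notin> free_space.span G"
  obtains f where "pairing f v \<noteq> 0" "\<And>w. w \<in> free_space.span G \<Longrightarrow> pairing f w = 0"
proof -
  interpret vector_space "(*) :: 'k \<Rightarrow> 'k \<Rightarrow> 'k"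
    by unfold_locales (auto simp: algebra_simps)
  interpret vs: vector_space_pair "free_scale :: 'k \<Rightarrow> (('a \<Rightarrow> real) set \<Rightarrow>\<^sub>0 'k) \<Rightarrow> ('a \<Rightarrow> real) set \<Rightarrow>\<^sub>0 'k" "(*) :: 'k \<Rightarrow> 'k \<Rightarrow> 'k" ..
  obtain B where B: "B \<subseteq> G" "free_space.independent B" "G \<subseteq> free_space.span B"
    using free_space.maximal_independent_subset by metis
  have GB: "free_space.span G \<subseteq> free_space.span B"
    using free_space.span_minimal[OF B(3)] free_space.subspace_span by blast
  have BG: "free_space.span B \<subseteq> free_space.span G" using free_space.span_mono[OF B(1)] .
  have vB: "v \<notin> free_space.span B" using assms BG by blast
  then have "free_space.independent (insert v B)"
    using B(2) free_space.independent_insertI by blast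
  then obtain \<phi> where \<phi>: "Vector_Spaces.linear free_scale (*) \<phi>"
    "\<forall>x\<in>insert v B. \<phi> x = (if x = v then 1 else 0)"
    using vs.linear_independent_extend[of "insert v B" "\<lambda>x. if x = v then 1 else 0"] by blast
  interpret \<phi>: Vector_Spaces.linear free_scale "(*) :: 'k \<Rightarrow> 'k \<Rightarrow> 'k" \<phi> by (rule \<phi>(1))
  define f where "f X = \<phi> (Poly_Mapping.single X 1)" for X
  have pair: "pairing f w = \<phi> w" for w
  proof -
    have "w = (\<Sum>X\<in>Poly_Mapping.keys w. free_scale (Poly_Mapping.lookup w X) (Poly_Mapping.single X 1))"
      by (rule poly_mapping_eqI)
        (simp add: Poly_Mapping.lookup_sum Poly_Mapping.lookup_single Poly_Mapping.when_def
          in_keys_iff if_distrib[where f = "(*) _"] sum.delta cong: if_cong)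
    then have "\<phi> w = (\<Sum>X\<in>Poly_Mapping.keys w. Poly_Mapping.lookup w X * \<phi> (Poly_Mapping.single X 1))"
      by (metis (no_types, lifting) \<phi>.scale \<phi>.sum sum.cong)
    then show ?thesis by (simp add: pairing_def f_def)
  qed
  have "\<phi> v = 1" using \<phi>(2) by simp
  moreover have "\<phi> b = 0" if "b \<in> B" for b
    using \<phi>(2) that vB free_space.span_base by fastforce
  then have "\<phi> w = 0" if "w \<in> free_space.span G" for w
    using that GB vs.linear_eq_0_on_span[OF \<phi>(1)] by blast
  ultimately show thesis using that[of f] pair by simp
qed

text \<open>A functional kills the Steinmann generators iff its first derivatives are invariant
  under adjacency, that is iff it lies in \<open>Gamma_star\<close>. A vector outside
  \<open>Stein I\<close> is then detected by a separating functional.\<close>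

lemma annihilator_Gamma_star:
  fixes v :: "('a \<Rightarrow> real) set \<Rightarrow>\<^sub>0 'k::field"
  assumes fin: "finite I" and ne: "I \<noteq> {}" and v: "v \<in> Lvee I {I}"
  shows "(\<forall>f\<in>Gamma_star I {I}. pairing f v = 0) \<longleftrightarrow> v \<in> Stein I"
proof
  note part = partition_on_whole[OF ne]
  have Q: "cut_partition {I} (S, T) = {S, T}" if "is_cut {I} (S, T)" for S T
    using that by auto
  have partQ: "partition_on I {S, T}" if "is_cut {I} (S, T)" for S T
    using partition_on_cut_partition[OF part that] Q[OF that] by simp
  have swap: "is_cut {I} (T, S)" if "is_cut {I} (S, T)" for S T
    using is_cut_swap[of "{I}" "(S, T)"] that by simp
  have deriv: "cut_deriv I {I} (S, T) f X = f (cut_face I {I} (S, T) X) - f (cut_face I {I} (T, S) X)"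
    if "is_cut {I} (S, T)" "X \<in> adjoint_faces I {S, T}" for S T X and f :: "_ \<Rightarrow> 'k"
    using that Q[OF that(1)] by (simp add: cut_deriv_def)
  have func: "cut_deriv I {I} (S, T) f \<in> functionals I {S, T}"
    if "is_cut {I} (S, T)" for S T and f :: "_ \<Rightarrow> 'k"
    using cut_deriv_functional[of I "{I}" "(S, T)" f] Q[OF that] by simp
  define gen :: "_ \<Rightarrow> _ \<Rightarrow> _ \<Rightarrow> _ \<Rightarrow> ('a \<Rightarrow> real) set \<Rightarrow>\<^sub>0 'k" where
    "gen S T X1 X2 = Poly_Mapping.single (cut_face I {I} (S, T) X1) 1
      - Poly_Mapping.single (cut_face I {I} (T, S) X1) 1
      + Poly_Mapping.single (cut_face I {I} (T, S) X2) 1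
      - Poly_Mapping.single (cut_face I {I} (S, T) X2) 1" for S T X1 X2
  define G where "G = {gen S T X1 X2 | S T X1 X2. is_cut {I} (S, T) \<and> steinmann_adjacent I {S, T} X1 X2}"
  have Stein: "Stein I = free_space.span G" by (simp add: Stein_def G_def gen_def)
  have pair_gen: "pairing f (gen S T X1 X2) = cut_deriv I {I} (S, T) f X1 - cut_deriv I {I} (S, T) f X2"
    if "is_cut {I} (S, T)" "steinmann_adjacent I {S, T} X1 X2" for S T X1 X2 f
    using that deriv[OF that(1)]
    by (simp add: gen_def pairing_add pairing_diff pairing_single steinmann_adjacent_def)
  {
    assume "v \<in> Stein I"
    show "\<forall>f\<in>Gamma_star I {I}. pairing f v = 0"
    proof
      fix f :: "('a \<Rightarrow> real) set \<Rightarrow> 'k" assume "f \<in> Gamma_star I {I}"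
      then have f: "\<forall>S T. is_cut {I} (S, T) \<longrightarrow> semisimple I {S, T} (cut_deriv I {I} (S, T) f)"
        using semisimply_differentiable_iff[OF fin ne] by (auto simp: Gamma_star_def)
      have "G \<subseteq> {v. pairing f v = 0}"
      proof
        fix w assume "w \<in> G"
        then obtain S T X1 X2 where w: "w = gen S T X1 X2" and ST: "is_cut {I} (S, T)"
          and adj: "steinmann_adjacent I {S, T} X1 X2" unfolding G_def by blast
        have "cut_deriv I {I} (S, T) f X1 = cut_deriv I {I} (S, T) f X2"
          using f ST adj semisimple_iff_adjacent_invariant[OF partQ[OF ST] fin func[OF ST]] by blast
        then show "w \<in> {v. pairing f v = 0}" using pair_gen[OF ST adj] w by simp
      qed
      then have "Stein I \<subseteq> {v. pairing f v = 0}"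
        unfolding Stein by (rule free_space.span_minimal[OF _ subspace_pairing_zero])
      with \<open>v \<in> Stein I\<close> show "pairing f v = 0" by blast
    qed
  next
    assume *: "\<forall>f\<in>Gamma_star I {I}. pairing f v = 0"
    show "v \<in> Stein I"
    proof (rule ccontr)
      assume "v \<notin> Stein I"
      then obtain g where g: "pairing g v \<noteq> 0" "\<And>w. w \<in> Stein I \<Longrightarrow> pairing g w = 0"
        using separating_functional[of v G] unfolding Stein by metis
      \<comment> \<open>The separating functional may be nonzero off the chambers. Truncation puts
        it into \<open>functionals I {I}\<close> and leaves its pairing with elements of
        \<open>Lvee I {I}\<close> unchanged.\<close>
      define f where "f X = (if X \<in> adjoint_faces I {I} then g X else 0)" for X
      have f: "f \<in> functionals I {I}" by (simp add: functionals_def f_def)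
      have fg: "pairing f w = pairing g w" if "w \<in> Lvee I {I}" for w
        unfolding pairing_def using that by (intro sum.cong) (auto simp: f_def Lvee_def)
      have "semisimple I {S, T} (cut_deriv I {I} (S, T) f)" if ST: "is_cut {I} (S, T)" for S T
        unfolding semisimple_iff_adjacent_invariant[OF partQ[OF ST] fin func[OF ST]]
      proof (intro allI impI)
        fix X1 X2 assume adj: "steinmann_adjacent I {S, T} X1 X2"
        have faces: "cut_face I {I} V X \<in> adjoint_faces I {I}"
          if "V \<in> {(S, T), (T, S)}" "X \<in> {X1, X2}" for V X
          using that adj ST swap[OF ST] Q[OF ST] Q[OF swap[OF ST]]
          by (intro cut_face_in_adjoint_faces[OF part fin])
            (auto simp: steinmann_adjacent_def insert_commute)
        have "gen S T X1 X2 \<in> Stein I"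
          unfolding Stein G_def using ST adj by (intro free_space.span_base) blast
        then have "0 = pairing g (gen S T X1 X2)" using g(2) by simp
        also have "\<dots> = pairing f (gen S T X1 X2)"
          using faces by (simp add: gen_def pairing_add pairing_diff pairing_single f_def del: cut_face.simps)
        finally show "cut_deriv I {I} (S, T) f X1 = cut_deriv I {I} (S, T) f X2"
          using pair_gen[OF ST adj, of f] by simp
      qed
      then have "f \<in> Gamma_star I {I}"
        using f semisimply_differentiable_iff[OF fin ne f] by (simp add: Gamma_star_def)
      with * g(1) fg[OF v] show False by simp
    qed
  }
qed

section \<open>The quotient space\<close>

lemma Lvee_diff: "v \<in> Lvee I P \<Longrightarrow> w \<in> Lvee I P \<Longrightarrow> v - w \<in> Lvee I P"
  using Poly_Mapping.keys_diff[of v w] by (auto simp: Lvee_def)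

theorem theorem4p3:
  fixes I :: "'a set"
  assumes "finite I" and "I \<noteq> {}"
  shows "(\<forall>f \<in> (functionals I {I} :: (('a \<Rightarrow> real) set \<Rightarrow> 'k::field_char_0) set).
            semisimply_differentiable I {I} f \<longleftrightarrow>
            (\<forall>S T. is_cut {I} (S, T) \<longrightarrow> semisimple I {S, T} (cut_deriv I {I} (S, T) f)))
       \<and> (Gamma I {I} :: (('a \<Rightarrow> real) set \<Rightarrow>\<^sub>0 'k) set set) = quotient_space (Lvee I {I}) (Stein I)"
proof
  show "\<forall>f \<in> (functionals I {I} :: (('a \<Rightarrow> real) set \<Rightarrow> 'k) set).
      semisimply_differentiable I {I} f \<longleftrightarrow>
      (\<forall>S T. is_cut {I} (S, T) \<longrightarrow> semisimple I {S, T} (cut_deriv I {I} (S, T) f))"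
    using semisimply_differentiable_iff[OF assms] by blast
  \<comment> \<open>Both quotients are taken by the same relation: differences of elements of
    \<open>Lvee I {I}\<close> stay in it, and there the common kernel coincides with
    \<open>Stein I\<close>.\<close>
  have "{(x, y). x \<in> Lvee I {I} \<and> y \<in> Lvee I {I} \<and>
        x - y \<in> {v \<in> Lvee I {I}. \<forall>f\<in>Gamma_star I {I}. pairing f v = 0}} =
      {(x, y). x \<in> Lvee I {I} \<and> y \<in> Lvee I {I} \<and> x - y \<in> (Stein I :: (_ \<Rightarrow>\<^sub>0 'k) set)}"
    using Lvee_diff annihilator_Gamma_star[OF assms] by blast
  then show "(Gamma I {I} :: (('a \<Rightarrow> real) set \<Rightarrow>\<^sub>0 'k) set set) = quotient_space (Lvee I {I}) (Stein I)"
    unfolding Gamma_def quotient_space_def by simp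
qed

end
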